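(* Let $n,t\ge1$ be integers and $\mathbb R[X]:=\mathbb R[X_1,\ldots,X_n]$. Let $\mathcal G\subseteq\mathcal S_t(\mathbb R[X])$ be a finite set of homogeneous polynomial matrices of even degrees. Let $\mathbf F\in\mathcal S_t(\mathbb R[X])$ be a homogeneous polynomial matrix of even degree $d>0$. If $\mathbf F(x)>0$ (positive definite) for all $x\in K(\mathcal G)\setminus\{0\}$, then there exist a finite set $G$ of homogeneous polynomials in $\mathbb R[X]$ of even degrees and an integer $N>0$ such that $$\Big(\sum_{i=1}^nX_i^2\Big)^N\mathbf F\in M(G)^t\subseteq\mathcal M(\mathcal G).$$
   Context: $\mathcal M_t(\mathbb R[X])$ is the algebra of $t\times t$ matrices over $\mathbb R[X]$ ("polynomial matrices"), and $\mathcal S_t(\mathbb R[X])$ its subset of symmetric matrices. The degree of a polynomial matrix is the maximum of the degrees of its entries; it is homogeneous of degree $d$ if it has the form $\sum_{|\alpha|=d}\mathbf A_\alpha X^\alpha$ with $\mathbf A_\alpha\in\mathcal M_t(\mathbb R)$. For $\mathcal G\subseteq\mathcal S_t(\mathbb R[X])$, $K(\mathcal G)=\{x\in\mathbb R^n:\mathbf G(x)\text{ is positive semidefinite for all }\mathbf G\in\mathcal G\}$, and $\mathcal M(\mathcal G)$ is the quadratic module generated by $\mathcal G$: the set of all finite sums of matrices $\mathbf A^T\mathbf G\mathbf A$ with $\mathbf G\in\mathcal G\cup\{\mathbf I\}$ and $\mathbf A\in\mathcal M_t(\mathbb R[X])$. For $G\subseteq\mathbb R[X]$, $M(G)$ is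 the set of all $\sigma_0+\sum_{i=1}^m\sigma_ig_i$ with $m\in\mathbb N$, $g_i\in G$ and $\sigma_i$ finite sums of squares of polynomials in $\mathbb R[X]$. For a quadratic module $M\subseteq\mathbb R[X]$, $M^t$ is the set of all finite sums $\sum_i m_i\mathbf A_i^T\mathbf A_i$ with $m_i\in M$ and $\mathbf A_i\in\mathcal M_t(\mathbb R[X])$. *)

theory Defs
  imports "HOL-Analysis.Analysis" "HOL-Library.Poly_Mapping"
begin

text \<open>
  The ring \<open>\<real>[X\<^sub>1, \<dots>, X\<^sub>n]\<close> is the convolution ring of finitely supported functions from exponent
  vectors to coefficients; the variables are indexed by a finite type \<open>'n\<close> with \<open>n = CARD('n) \<ge> 1\<close>.
  Polynomial matrices are matrices over this ring, with index type \<open>'t\<close> and \<open>t = CARD('t) \<ge> 1\<close>.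
\<close>

type_synonym 'n mono = "'n \<Rightarrow>\<^sub>0 nat"
type_synonym 'n rpoly = "'n mono \<Rightarrow>\<^sub>0 real"
type_synonym ('n, 't) pmat = "'n rpoly ^ 't ^ 't"

definition Var :: "'n \<Rightarrow> 'n::finite rpoly" where
  "Var i = Poly_Mapping.single (Poly_Mapping.single i 1) 1"

definition mono_degree :: "'n::finite mono \<Rightarrow> nat" where
  "mono_degree \<alpha> = (\<Sum>i\<in>UNIV. Poly_Mapping.lookup \<alpha> i)"

definition poly_eval :: "'n::finite rpoly \<Rightarrow> real ^ 'n \<Rightarrow> real" where
  "poly_eval p x =
     (\<Sum>\<alpha>\<in>Poly_Mapping.keys p. Poly_Mapping.lookup p \<alpha> * (\<Prod>i\<in>UNIV. (x $ i) ^ Poly_Mapping.lookup \<alpha> i))"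

definition pmat_eval :: "('n::finite, 't::finite) pmat \<Rightarrow> real ^ 'n \<Rightarrow> real ^ 't ^ 't" where
  "pmat_eval A x = map_matrix (\<lambda>p. poly_eval p x) A"

definition sym_matrix :: "'a ^ 't ^ 't \<Rightarrow> bool" where
  "sym_matrix A \<longleftrightarrow> transpose A = A"

definition pos_semidef :: "real ^ 't ^ 't \<Rightarrow> bool" where
  "pos_semidef A \<longleftrightarrow> sym_matrix A \<and> (\<forall>v. 0 \<le> v \<bullet> (A *v v))"

definition pos_def :: "real ^ 't ^ 't \<Rightarrow> bool" where
  "pos_def A \<longleftrightarrow> sym_matrix A \<and> (\<forall>v. v \<noteq> 0 \<longrightarrow> 0 < v \<bullet> (A *v v))"

text \<open>As usual, the zero polynomial (matrix) is homogeneous of every degree.\<close>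

definition homogeneous_poly :: "nat \<Rightarrow> 'n::finite rpoly \<Rightarrow> bool" where
  "homogeneous_poly d p \<longleftrightarrow> (\<forall>\<alpha>\<in>Poly_Mapping.keys p. mono_degree \<alpha> = d)"

text \<open>For a real matrix \<open>C\<close>, the matrix \<open>map_matrix (Poly_Mapping.single \<alpha>) C\<close> is \<open>C X\<^sup>\<alpha>\<close>.\<close>

definition homogeneous_pmat :: "nat \<Rightarrow> ('n::finite, 't::finite) pmat \<Rightarrow> bool" where
  "homogeneous_pmat d A \<longleftrightarrow>
     (\<exists>C :: 'n mono \<Rightarrow> real ^ 't ^ 't.
        A = (\<Sum>\<alpha> | mono_degree \<alpha> = d. map_matrix (Poly_Mapping.single \<alpha>) (C \<alpha>)))"

definition psd_set :: "('n::finite, 't::finite) pmat set \<Rightarrow> (real ^ 'n) set" where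
  "psd_set \<G> = {x. \<forall>G\<in>\<G>. pos_semidef (pmat_eval G x)}"

definition qmodule_pmat :: "('n::finite, 't::finite) pmat set \<Rightarrow> ('n, 't) pmat set" where
  "qmodule_pmat \<G> =
     {(\<Sum>i<m. transpose (A i) ** H i ** A i) | (m::nat) A H. \<forall>i<m. H i \<in> insert (mat 1) \<G>}"

definition sos :: "'n::finite rpoly set" where
  "sos = {(\<Sum>i<k. q i ^ 2) | (k::nat) q. True}"

definition qmodule_poly :: "'n::finite rpoly set \<Rightarrow> 'n rpoly set" where
  "qmodule_poly G =
     {\<sigma>\<^sub>0 + (\<Sum>i<m. \<sigma> i * g i) | (m::nat) \<sigma>\<^sub>0 \<sigma> g. \<sigma>\<^sub>0 \<in> sos \<and> (\<forall>i<m. \<sigma> i \<in> sos \<and> g i \<in> G)}"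

definition scale_pmat :: "'n::finite rpoly \<Rightarrow> ('n, 't::finite) pmat \<Rightarrow> ('n, 't) pmat" where
  "scale_pmat p A = map_matrix ((*) p) A"

text \<open>
  \<open>M\<^sup>t\<close>, where \<open>t\<close> is determined by the matrix type. Without the type constraint on \<open>A\<close> the
  matrices \<open>A i\<close> could be rectangular.
\<close>

definition matrix_cone :: "'n::finite rpoly set \<Rightarrow> ('n, 't::finite) pmat set" where
  "matrix_cone M =
     {(\<Sum>i<k. scale_pmat (\<mu> i) (transpose (A i) ** A i))
       | (k::nat) \<mu> (A :: nat \<Rightarrow> ('n, 't) pmat). \<forall>i<k. \<mu> i \<in> M}"

text \<open>The sum in \<open>homogeneous_pmat\<close> ranges over a finite set, so it is a genuine sum.\<close>

lemma finite_mono_degree: "finite {\<alpha> :: 'n::finite mono. mono_degree \<alpha> = d}"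
proof (rule finite_imageD)
  have "Poly_Mapping.lookup ` {\<alpha> :: 'n mono. mono_degree \<alpha> = d} \<subseteq> Pi UNIV (\<lambda>_. {..d})"
    by (auto simp: mono_degree_def intro!: member_le_sum)
  also have "\<dots> = PiE UNIV (\<lambda>_. {..d})" by (simp add: PiE_def)
  finally show "finite (Poly_Mapping.lookup ` {\<alpha> :: 'n mono. mono_degree \<alpha> = d})"
    by (rule finite_subset) (simp add: finite_PiE)
  show "inj_on Poly_Mapping.lookup {\<alpha> :: 'n mono. mono_degree \<alpha> = d}"
    by (auto simp: inj_on_def Poly_Mapping.lookup_inject)
qed

lemma homogeneous_pmat_iff:
  "homogeneous_pmat d A \<longleftrightarrow> (\<forall>i j. homogeneous_poly d (A $ i $ j))"
proof
  assume "homogeneous_pmat d A"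
  then obtain C :: "'a mono \<Rightarrow> real ^ 'b ^ 'b" where
    A: "A = (\<Sum>\<alpha> | mono_degree \<alpha> = d. map_matrix (Poly_Mapping.single \<alpha>) (C \<alpha>))"
    unfolding homogeneous_pmat_def by blast
  have "mono_degree \<beta> = d" if "\<beta> \<in> Poly_Mapping.keys (A $ i $ j)" for i j \<beta>
  proof (rule ccontr)
    assume "mono_degree \<beta> \<noteq> d"
    then have "Poly_Mapping.lookup (A $ i $ j) \<beta> = 0"
      unfolding A sum_component lookup_sum nth_map_matrix
      by (intro sum.neutral) (auto simp: lookup_single when_def)
    with that show False by (simp add: in_keys_iff)
  qed
  then show "\<forall>i j. homogeneous_poly d (A $ i $ j)"
    by (simp add: homogeneous_poly_def)
next
  assume h: "\<forall>i j. homogeneous_poly d (A $ i $ j)"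
  define C where "C = (\<lambda>\<alpha>. map_matrix (\<lambda>p. Poly_Mapping.lookup p \<alpha>) A)"
  have "A $ i $ j = (\<Sum>\<alpha> | mono_degree \<alpha> = d. Poly_Mapping.single \<alpha> (Poly_Mapping.lookup (A $ i $ j) \<alpha>))"
    for i j
  proof (rule poly_mapping_eqI)
    fix \<beta>
    show "Poly_Mapping.lookup (A $ i $ j) \<beta> =
      Poly_Mapping.lookup (\<Sum>\<alpha> | mono_degree \<alpha> = d. Poly_Mapping.single \<alpha> (Poly_Mapping.lookup (A $ i $ j) \<alpha>)) \<beta>"
    proof (cases "mono_degree \<beta> = d")
      case True
      then show ?thesis
        by (simp add: lookup_sum lookup_single when_def finite_mono_degree)
    next
      case False
      then have "Poly_Mapping.lookup (A $ i $ j) \<beta> = 0"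
        using h by (metis homogeneous_poly_def in_keys_iff)
      moreover have "(\<Sum>\<alpha> | mono_degree \<alpha> = d.
          Poly_Mapping.lookup (Poly_Mapping.single \<alpha> (Poly_Mapping.lookup (A $ i $ j) \<alpha>)) \<beta>) = 0"
        using False by (intro sum.neutral) (auto simp: lookup_single when_def)
      ultimately show ?thesis by (simp add: lookup_sum)
    qed
  qed
  then have "A = (\<Sum>\<alpha> | mono_degree \<alpha> = d. map_matrix (Poly_Mapping.single \<alpha>) (C \<alpha>))"
    by (simp add: vec_eq_iff sum_component C_def)
  then show "homogeneous_pmat d A"
    unfolding homogeneous_pmat_def by blast
qed

end

theory Submission
  imports Defs
begin

text \<open>
  If \<open>A \<in> \<G>\<close> and \<open>x\<close> is a point where \<open>A(x)\<close> is not positive semidefinite, then some form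
  \<open>g = v\<^sup>T A v\<close> is negative at \<open>x\<close>, and \<open>g I\<close> lies in the quadratic module generated by \<open>\<G>\<close>.
  By compactness of the sphere, finitely many such scalar forms \<open>g\<close> suffice: \<open>F\<close> is positive
  definite at all points of the sphere where they are nonnegative. On the sphere one can then subtract
  multiples \<open>c (g - 1)\<^bsup>2k\<^esup> g\<close> of the identity from \<open>F\<close> so that the difference is positive definite
  everywhere, and after homogenisation it remains to treat a form \<open>H\<close> that is positive definite away
  from \<open>0\<close>. Such an \<open>H\<close> is written in the squares \<open>u\<^sub>l\<close> of suitably scaled linear forms
  \<open>X\<^sub>i \<plusminus> X\<^sub>j\<close>, whose sum is \<open>X\<^sub>1\<^sup>2 + \<dots> + X\<^sub>n\<^sup>2\<close>. Modulo a penalty which represents the zero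
  polynomial and vanishes only on the Veronese variety, \<open>H\<close> becomes positive definite on
  the whole simplex, and Polya's argument gives an expansion of \<open>(X\<^sub>1\<^sup>2 + \<dots> + X\<^sub>n\<^sup>2)\<^sup>N H\<close> into
  products of the \<open>u\<^sub>l\<close> with positive semidefinite real coefficient matrices.
\<close>

section \<open>Evaluation and homogeneity of polynomials\<close>

abbreviation Const :: "real \<Rightarrow> 'n::finite rpoly" where
  "Const c \<equiv> Poly_Mapping.single 0 c"

definition sq_norm :: "'n::finite rpoly" where
  "sq_norm = (\<Sum>i\<in>UNIV. Var i ^ 2)"

lemma rpoly_expand:
  fixes p :: "'n::finite rpoly"
  assumes "finite S" and "Poly_Mapping.keys p \<subseteq> S"
  shows "p = (\<Sum>\<alpha>\<in>S. Poly_Mapping.single \<alpha> (Poly_Mapping.lookup p \<alpha>))"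
  using assms
  by (intro poly_mapping_eqI)
    (auto simp: lookup_sum lookup_single when_def sum.delta in_keys_iff subset_iff)

text \<open>Every polynomial is a finite sum of terms, so additive properties can be checked on
  single terms; the empty sum is the term with coefficient 0.\<close>

lemma rpoly_induct [case_names single add]:
  fixes p :: "'n::finite rpoly"
  assumes single: "\<And>\<alpha> c. P (Poly_Mapping.single \<alpha> c)"
    and add: "\<And>p q. P p \<Longrightarrow> P q \<Longrightarrow> P (p + q)"
  shows "P p"
proof -
  have "P (\<Sum>\<alpha>\<in>S. Poly_Mapping.single \<alpha> (Poly_Mapping.lookup p \<alpha>))" if "finite S" for S
    using that
  proof (induction S)
    case empty
    show ?case using single[of 0 0] by simp
  next
    case (insert \<alpha> S)
    then show ?case by (simp add: add single)
  qed
  then show ?thesis by (metis rpoly_expand finite_keys order_refl)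
qed

lemma poly_eval_superset:
  fixes p :: "'n::finite rpoly"
  assumes "finite S" and "Poly_Mapping.keys p \<subseteq> S"
  shows "poly_eval p x =
    (\<Sum>\<alpha>\<in>S. Poly_Mapping.lookup p \<alpha> * (\<Prod>i\<in>UNIV. (x $ i) ^ Poly_Mapping.lookup \<alpha> i))"
  unfolding poly_eval_def using assms
  by (intro sum.mono_neutral_left) (auto simp: in_keys_iff)

lemma poly_eval_0 [simp]: "poly_eval 0 x = 0"
  by (simp add: poly_eval_def)

lemma poly_eval_single:
  "poly_eval (Poly_Mapping.single \<alpha> c) x = c * (\<Prod>i\<in>UNIV. (x $ i) ^ Poly_Mapping.lookup \<alpha> i)"
  by (subst poly_eval_superset[of "{\<alpha>}"]) auto

lemma poly_eval_Const [simp]: "poly_eval (Const c) x = c"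
  by (simp add: poly_eval_single)

lemma poly_eval_1 [simp]: "poly_eval 1 x = 1"
  using poly_eval_Const[of 1 x] by simp

lemma poly_eval_add [simp]: "poly_eval (p + q) x = poly_eval p x + poly_eval q x"
proof -
  let ?S = "Poly_Mapping.keys p \<union> Poly_Mapping.keys q"
  show ?thesis
    using keys_add[of p q]
    by (simp add: poly_eval_superset[of ?S] lookup_add distrib_right sum.distrib)
qed

lemma poly_eval_mult [simp]: "poly_eval (p * q) x = poly_eval p x * poly_eval q x"
proof (induction p rule: rpoly_induct)
  case (single \<alpha> c)
  show ?case
  proof (induction q rule: rpoly_induct)
    case (single \<beta> d)
    show ?case
      by (simp add: mult_single poly_eval_single lookup_add power_add prod.distrib)
  next
    case (add p q)
    then show ?case by (simp add: distrib_left)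
  qed
next
  case (add p q)
  then show ?case by (simp add: distrib_right)
qed

lemma poly_eval_uminus [simp]: "poly_eval (- p) x = - poly_eval p x"
  using poly_eval_add[of p "- p" x] by simp

lemma poly_eval_diff [simp]: "poly_eval (p - q) x = poly_eval p x - poly_eval q x"
  using poly_eval_add[of p "- q" x] by simp

lemma poly_eval_power [simp]: "poly_eval (p ^ k) x = poly_eval p x ^ k"
  by (induction k) simp_all

lemma poly_eval_sum [simp]: "poly_eval (\<Sum>a\<in>A. f a) x = (\<Sum>a\<in>A. poly_eval (f a) x)"
  by (induction A rule: infinite_finite_induct) simp_all

lemma poly_eval_Var [simp]: "poly_eval (Var i) x = x $ i"
proof -
  have "(\<Prod>j\<in>UNIV. (x $ j) ^ Poly_Mapping.lookup (Poly_Mapping.single i 1) j) =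
    (\<Prod>j\<in>UNIV. if j = i then x $ i else 1)"
    by (intro prod.cong) (auto simp: lookup_single when_def)
  then show ?thesis by (simp add: Var_def poly_eval_single)
qed

lemma poly_eval_sq_norm [simp]: "poly_eval sq_norm x = norm x ^ 2"
  by (simp add: sq_norm_def norm_vec_def L2_set_def sum_nonneg)

lemma continuous_on_poly_eval [continuous_intros]:
  "continuous_on S f \<Longrightarrow> continuous_on S (\<lambda>x. poly_eval p (f x))"
  unfolding poly_eval_def by (intro continuous_intros)

lemma Const_mult: "Const a * Const b = Const (a * b)"
  by (simp add: mult_single)

lemma Const_mult_left: "Const a * (Const b * p) = Const (a * b) * p"
  by (simp add: mult.assoc[symmetric] mult_single)

lemma Const_power: "Const a ^ k = Const (a ^ k)"
  by (induction k) (simp_all add: mult_single)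

lemma Const_sum: "Const (\<Sum>a\<in>A. f a) = (\<Sum>a\<in>A. Const (f a))"
  by (induction A rule: infinite_finite_induct) (simp_all add: single_add)

section \<open>Degrees of monomials and homogeneous polynomials\<close>

lemma mono_degree_0 [simp]: "mono_degree 0 = 0"
  by (simp add: mono_degree_def)

lemma mono_degree_add [simp]: "mono_degree (\<alpha> + \<beta>) = mono_degree \<alpha> + mono_degree \<beta>"
  by (simp add: mono_degree_def lookup_add sum.distrib)

lemma mono_degree_single [simp]: "mono_degree (Poly_Mapping.single i k) = k"
  by (simp add: mono_degree_def lookup_single when_def)

lemma homogeneous_poly_0 [simp]: "homogeneous_poly d 0"
  by (simp add: homogeneous_poly_def)

lemma homogeneous_poly_Const [simp]: "homogeneous_poly 0 (Const c)"
  by (simp add: homogeneous_poly_def)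

lemma homogeneous_poly_1 [simp]: "homogeneous_poly 0 1"
  using homogeneous_poly_Const[of 1] by simp

lemma homogeneous_poly_Var [simp]: "homogeneous_poly 1 (Var i)"
  by (simp add: homogeneous_poly_def Var_def)

lemma homogeneous_poly_add:
  "homogeneous_poly d p \<Longrightarrow> homogeneous_poly d q \<Longrightarrow> homogeneous_poly d (p + q)"
  using keys_add[of p q] by (auto simp: homogeneous_poly_def)

lemma homogeneous_poly_uminus: "homogeneous_poly d p \<Longrightarrow> homogeneous_poly d (- p)"
  by (simp add: homogeneous_poly_def in_keys_iff)

lemma homogeneous_poly_diff:
  "homogeneous_poly d p \<Longrightarrow> homogeneous_poly d q \<Longrightarrow> homogeneous_poly d (p - q)"
  using homogeneous_poly_add[of d p "- q"] by (simp add: homogeneous_poly_uminus)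

lemma homogeneous_poly_sum:
  "(\<And>a. a \<in> A \<Longrightarrow> homogeneous_poly d (f a)) \<Longrightarrow> homogeneous_poly d (\<Sum>a\<in>A. f a)"
  by (induction A rule: infinite_finite_induct) (auto intro: homogeneous_poly_add)

lemma homogeneous_poly_mult:
  "homogeneous_poly d p \<Longrightarrow> homogeneous_poly e q \<Longrightarrow> homogeneous_poly (d + e) (p * q)"
  using keys_mult[of p q] by (fastforce simp: homogeneous_poly_def)

lemma homogeneous_poly_power: "homogeneous_poly d p \<Longrightarrow> homogeneous_poly (k * d) (p ^ k)"
  by (induction k) (auto intro: homogeneous_poly_mult)

lemma homogeneous_sq_norm: "homogeneous_poly 2 sq_norm"
  unfolding sq_norm_def
  by (intro homogeneous_poly_sum) (use homogeneous_poly_power[OF homogeneous_poly_Var, of 2] in simp)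

section \<open>Polya's theorem for words\<close>

text \<open>Words take the place of exponent vectors: a power of a sum expands into all words with
  coefficient 1, so no multinomial coefficients have to be estimated.\<close>

definition words :: "nat \<Rightarrow> 'l list set" where
  "words N = {w. length w = N}"

text \<open>A nonempty word gives a point of the standard simplex; the empty word gives 0, as
  division by 0 yields 0.\<close>

definition freq :: "'l list \<Rightarrow> real ^ 'l" where
  "freq w = (\<chi> l. real (count_list w l) / real (length w))"

lemma finite_words [simp]: "finite (words N :: 'l::finite list set)"
  using finite_lists_length_eq[of "UNIV :: 'l set" N] by (simp add: words_def)

text \<open>The entries are nonnegative with sum at most 1. All frequency vectors thus lie in one
  compact ball, on which continuous symbols are uniformly continuous.\<close>

lemma norm_freq_le: "norm (freq w :: real ^ 'l::finite) \<le> 1"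
proof -
  have "norm (freq w) \<le> (\<Sum>l\<in>UNIV. \<bar>freq w $ l\<bar>)" by (rule norm_le_l1_cart)
  also have "\<dots> = real (\<Sum>l\<in>UNIV. count_list w l) / real (length w)"
    by (simp add: freq_def sum_divide_distrib)
  also have "(\<Sum>l\<in>UNIV. count_list w l) = (\<Sum>l\<in>set w. count_list w l)"
    by (rule sum.mono_neutral_right) (auto simp: count_list_0_iff)
  also have "\<dots> = length w" by (rule sum_count_set) auto
  finally show ?thesis by (simp add: divide_le_eq_1 split: if_splits)
qed

text \<open>A new letter moves the frequency vector towards the vertex \<open>axis l 1\<close>, by
  the fraction \<open>1 / Suc (length w)\<close> of the difference.\<close>

lemma dist_freq_Cons: "dist (freq (l # w)) (freq w :: real ^ 'l::finite) \<le> 2 / real (Suc (length w))"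
proof -
  have "freq (l # w) - freq w = (1 / real (Suc (length w))) *\<^sub>R (axis l 1 - freq w)"
  proof (subst vec_eq_iff, intro allI)
    fix i
    have "real (count_list w i) = freq w $ i * real (length w)"
      by (cases "w = []") (auto simp: freq_def)
    then have "freq (l # w) $ i = (freq w $ i * real (length w) + (axis l 1 :: real ^ 'l) $ i) / real (Suc (length w))"
      by (simp add: freq_def axis_def)
    then have "freq (l # w) $ i - freq w $ i = ((axis l 1 :: real ^ 'l) $ i - freq w $ i) / real (Suc (length w))"
      by (simp add: divide_simps) (simp add: algebra_simps)
    then show "(freq (l # w) - freq w) $ i = ((1 / real (Suc (length w))) *\<^sub>R (axis l 1 - freq w)) $ i"
      by (simp del: of_nat_Suc)
  qed
  then have "dist (freq (l # w)) (freq w) = norm (axis l 1 - freq w) / real (Suc (length w))"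
    by (simp add: dist_norm)
  also have "norm (axis l 1 - freq w) \<le> 2"
    using norm_triangle_ineq4[of "axis l 1" "freq w"] norm_freq_le[of w] by (simp add: norm_axis_1)
  finally show ?thesis by (simp add: divide_right_mono)
qed

lemma freq_mset_cong: "mset v = mset w \<Longrightarrow> freq v = freq w"
  unfolding freq_def by (metis count_mset size_mset)

lemma mset_rotate [simp]: "mset (rotate k w) = mset w"
  proof (induction k)
  case (Suc k)
  have "mset (rotate1 v) = mset v" for v :: "'a list" by (cases v) auto
  then show ?case using Suc by simp
qed simp

text \<open>
  A form \<open>p\<close> has the symbol \<open>P\<close> if its products with high powers of \<open>\<Sum>l. u l\<close> expand into words in
  the letters \<open>u l\<close> whose coefficients approximate the values of \<open>P\<close> at the letter frequencies.
\<close>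

definition word_expansion ::
  "('l::finite \<Rightarrow> 'n::finite rpoly) \<Rightarrow> 'n rpoly \<Rightarrow> (real ^ 'l \<Rightarrow> real) \<Rightarrow> real \<Rightarrow> nat \<Rightarrow> ('l list \<Rightarrow> real) \<Rightarrow> bool"
  where "word_expansion u p P \<epsilon> N \<gamma> \<longleftrightarrow>
    p = (\<Sum>w\<in>words N. Const (\<gamma> w) * prod_list (map u w)) \<and>
    (\<forall>w\<in>words N. \<bar>\<gamma> w - P (freq w)\<bar> \<le> \<epsilon>)"

text \<open>\<open>D\<close> is the degree of \<open>p\<close> counted in letters. The truncated
  difference \<open>N - D\<close> is harmless because only large \<open>N\<close> matter. Symbols
  are not unique: relations between the letters can give the zero polynomial a nonzero
  symbol.\<close>

definition symbol :: "('l::finite \<Rightarrow> 'n::finite rpoly) \<Rightarrow> nat \<Rightarrow> 'n rpoly \<Rightarrow> (real ^ 'l \<Rightarrow> real) \<Rightarrow> bool" where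
  "symbol u D p P \<longleftrightarrow> continuous_on UNIV P \<and>
     (\<forall>\<epsilon>>0. \<forall>\<^sub>F N in sequentially. \<exists>\<gamma>. word_expansion u ((\<Sum>l\<in>UNIV. u l) ^ (N - D) * p) P \<epsilon> N \<gamma>)"

lemma symbol_continuous: "symbol u D p P \<Longrightarrow> continuous_on UNIV P"
  by (simp add: symbol_def)

lemma symbolD:
  "symbol u D p P \<Longrightarrow> \<epsilon> > 0 \<Longrightarrow>
    \<forall>\<^sub>F N in sequentially. \<exists>\<gamma>. word_expansion u ((\<Sum>l\<in>UNIV. u l) ^ (N - D) * p) P \<epsilon> N \<gamma>"
  by (simp add: symbol_def)

lemma word_expansion_add:
  assumes "word_expansion u p P \<epsilon> N \<gamma>" and "word_expansion u q Q \<delta> N \<eta>"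
  shows "word_expansion u (p + q) (\<lambda>y. P y + Q y) (\<epsilon> + \<delta>) N (\<lambda>w. \<gamma> w + \<eta> w)"
  unfolding word_expansion_def
proof (intro conjI ballI)
  show "p + q = (\<Sum>w\<in>words N. Const (\<gamma> w + \<eta> w) * prod_list (map u w))"
    using assms by (simp add: word_expansion_def distrib_right single_add sum.distrib)
  fix w :: "'a list" assume "w \<in> words N"
  then have "\<bar>\<gamma> w - P (freq w)\<bar> \<le> \<epsilon>" "\<bar>\<eta> w - Q (freq w)\<bar> \<le> \<delta>"
    using assms by (auto simp: word_expansion_def)
  then show "\<bar>\<gamma> w + \<eta> w - (P (freq w) + Q (freq w))\<bar> \<le> \<epsilon> + \<delta>" by linarith
qed

lemma word_expansion_scale:
  assumes "word_expansion u p P \<epsilon> N \<gamma>"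
  shows "word_expansion u (Const c * p) (\<lambda>y. c * P y) (\<bar>c\<bar> * \<epsilon>) N (\<lambda>w. c * \<gamma> w)"
  unfolding word_expansion_def
proof (intro conjI ballI)
  show "Const c * p = (\<Sum>w\<in>words N. Const (c * \<gamma> w) * prod_list (map u w))"
    using assms by (simp add: word_expansion_def sum_distrib_left Const_mult[symmetric] mult.assoc)
  fix w :: "'a list" assume "w \<in> words N"
  then have "\<bar>c\<bar> * \<bar>\<gamma> w - P (freq w)\<bar> \<le> \<bar>c\<bar> * \<epsilon>"
    using assms by (intro mult_left_mono) (auto simp: word_expansion_def)
  then show "\<bar>c * \<gamma> w - c * P (freq w)\<bar> \<le> \<bar>c\<bar> * \<epsilon>"
    by (simp add: abs_mult[symmetric] right_diff_distrib)
qed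

lemma word_expansion_mono:
  "word_expansion u p P \<epsilon> N \<gamma> \<Longrightarrow> \<epsilon> \<le> \<delta> \<Longrightarrow> word_expansion u p P \<delta> N \<gamma>"
  unfolding word_expansion_def by fastforce

section \<open>Sums over words, and closure properties of symbols\<close>

lemma words_Suc: "words (Suc N) = (\<lambda>(l, w). l # w) ` (UNIV \<times> words N)"
  by (auto simp: words_def image_iff length_Suc_conv)

lemma sum_words_Suc:
  "(\<Sum>w\<in>words (Suc N). f w) = (\<Sum>l\<in>UNIV. \<Sum>w\<in>words N. f (l # w :: 'l::finite list))"
  unfolding words_Suc
  by (subst sum.reindex) (auto simp: inj_on_def sum.cartesian_product case_prod_unfold)

lemma sum_power_words:
  fixes u :: "'l::finite \<Rightarrow> 'a::comm_semiring_1"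
  shows "(\<Sum>l\<in>UNIV. u l) ^ N = (\<Sum>w\<in>words N. prod_list (map u w))"
proof (induction N)
  case 0
  have "words 0 = {[] :: 'l list}" by (auto simp: words_def)
  then show ?case by simp
next
  case (Suc N)
  then show ?case
    by (simp add: sum_words_Suc sum_distrib_left[symmetric] sum_distrib_right[symmetric])
qed

text \<open>Rotation is injective and maps the finite set of words of a given length into itself, so
  it permutes them.\<close>

lemma sum_words_rotate: "(\<Sum>w\<in>words N. f (rotate k w)) = (\<Sum>w\<in>words N. f (w :: 'l::finite list))"
proof -
  have inj: "inj_on (rotate k) (words N :: 'l list set)"
    using bij_rotate1 bij_betw_funpow[of rotate1 UNIV k]
    by (metis bij_betw_imp_inj_on inj_on_subset rotate_def subset_UNIV)
  have "rotate k ` words N = (words N :: 'l list set)"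
    using inj by (intro endo_inj_surj) (auto simp: words_def finite_words[unfolded words_def])
  then show ?thesis
    using sum.reindex[OF inj, of f] by simp
qed

lemma symbol_one: "symbol u 0 1 (\<lambda>_. 1)"
proof -
  have "word_expansion u ((\<Sum>l\<in>UNIV. u l) ^ (N - 0) * 1) (\<lambda>_. 1) \<epsilon> N (\<lambda>_. 1)" if "\<epsilon> > 0" for N \<epsilon>
    using that by (simp add: word_expansion_def sum_power_words)
  then show ?thesis unfolding symbol_def by (intro conjI allI impI always_eventually continuous_on_const) blast
qed

lemma symbol_add:
  assumes p: "symbol u D p P" and q: "symbol u D q Q"
  shows "symbol u D (p + q) (\<lambda>y. P y + Q y)"
  unfolding symbol_def
proof (intro conjI allI impI)
  show "continuous_on UNIV (\<lambda>y. P y + Q y)"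
    by (intro continuous_intros symbol_continuous[OF p] symbol_continuous[OF q])
  fix \<epsilon> :: real assume "\<epsilon> > 0"
  then have e: "\<epsilon> / 2 > 0" by simp
  show "\<forall>\<^sub>F N in sequentially. \<exists>\<gamma>.
      word_expansion u ((\<Sum>l\<in>UNIV. u l) ^ (N - D) * (p + q)) (\<lambda>y. P y + Q y) \<epsilon> N \<gamma>"
    using symbolD[OF p e] symbolD[OF q e]
  proof eventually_elim
    case (elim N)
    then obtain \<gamma> \<eta> where
      "word_expansion u ((\<Sum>l\<in>UNIV. u l) ^ (N - D) * p) P (\<epsilon> / 2) N \<gamma>"
      "word_expansion u ((\<Sum>l\<in>UNIV. u l) ^ (N - D) * q) Q (\<epsilon> / 2) N \<eta>"
      by blast
    from word_expansion_add[OF this] show ?case by (auto simp: distrib_left)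
  qed
qed

lemma symbol_scale:
  assumes p: "symbol u D p P"
  shows "symbol u D (Const c * p) (\<lambda>y. c * P y)"
  unfolding symbol_def
proof (intro conjI allI impI)
  show "continuous_on UNIV (\<lambda>y. c * P y)"
    by (intro continuous_intros symbol_continuous[OF p])
  fix \<epsilon> :: real assume "\<epsilon> > 0"
  \<comment> \<open>The summand 1 keeps the denominator positive when \<open>c\<close> is 0.\<close>
  then have e: "\<epsilon> / (\<bar>c\<bar> + 1) > 0" and le: "\<bar>c\<bar> * (\<epsilon> / (\<bar>c\<bar> + 1)) \<le> \<epsilon>"
    by (simp_all add: field_simps)
  show "\<forall>\<^sub>F N in sequentially. \<exists>\<gamma>.
      word_expansion u ((\<Sum>l\<in>UNIV. u l) ^ (N - D) * (Const c * p)) (\<lambda>y. c * P y) \<epsilon> N \<gamma>"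
    using symbolD[OF p e]
  proof eventually_elim
    case (elim N)
    then obtain \<gamma> where
      "word_expansion u ((\<Sum>l\<in>UNIV. u l) ^ (N - D) * p) P (\<epsilon> / (\<bar>c\<bar> + 1)) N \<gamma>" by blast
    from word_expansion_mono[OF word_expansion_scale[OF this, of c] le]
    show ?case by (auto simp: ac_simps)
  qed
qed

text \<open>The \<open>k\<close> additional factors are taken from the power already present, so the
  same expansions serve. This brings symbols to a common degree before they are added.\<close>

lemma symbol_mult_letters:
  assumes p: "symbol u D p P"
  shows "symbol u (D + k) ((\<Sum>l\<in>UNIV. u l) ^ k * p) P"
  unfolding symbol_def
proof (intro conjI allI impI)
  show "continuous_on UNIV P" using p by (rule symbol_continuous)
  fix \<epsilon> :: real assume e: "\<epsilon> > 0"
  show "\<forall>\<^sub>F N in sequentially. \<exists>\<gamma>.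
      word_expansion u ((\<Sum>l\<in>UNIV. u l) ^ (N - (D + k)) * ((\<Sum>l\<in>UNIV. u l) ^ k * p)) P \<epsilon> N \<gamma>"
    using symbolD[OF p e] eventually_ge_at_top[of "D + k"]
  proof eventually_elim
    case (elim N)
    then show ?case by (simp add: mult.assoc[symmetric] power_add[symmetric])
  qed
qed

text \<open>The letters commute, so a word and its rotations have the same product, and coefficients
  may be averaged over rotations.\<close>

lemma symmetrise_words:
  fixes u :: "'l::finite \<Rightarrow> 'n::finite rpoly"
  shows "(\<Sum>w\<in>words (Suc N). Const (\<phi> w) * prod_list (map u w)) =
    (\<Sum>w\<in>words (Suc N). Const ((\<Sum>k<Suc N. \<phi> (rotate k w)) / real (Suc N)) * prod_list (map u w))"
proof -
  have rot: "prod_list (map u (rotate k w)) = prod_list (map u w)" for k w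
    by (metis mset_map mset_rotate prod_mset_prod_list)
  have "(\<Sum>w\<in>words (Suc N). Const (\<phi> w) * prod_list (map u w)) =
    (\<Sum>w\<in>words (Suc N). Const (\<phi> (rotate k w)) * prod_list (map u w))" for k
    using sum_words_rotate[of "\<lambda>w. Const (\<phi> w) * prod_list (map u w)" k "Suc N"] by (simp add: rot)
  note rotated = this
  define S where "S = (\<Sum>w\<in>words (Suc N). Const (\<phi> w) * prod_list (map u w))"
  \<comment> \<open>\<open>S\<close> is the average of \<open>Suc N\<close> copies of itself, and
    the copy with index \<open>k\<close> is then rotated by \<open>k\<close>.\<close>
  have "S = Const (1 / real (Suc N)) * (of_nat (Suc N) * S)"
  proof -
    have "Const (1 / real (Suc N)) * Const (real (Suc N)) = (1 :: 'n rpoly)"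
      unfolding Const_mult by (simp del: of_nat_Suc)
    then show ?thesis unfolding single_of_nat[of "Suc N"] by (simp only: mult.assoc[symmetric] mult_1)
  qed
  also have "of_nat (Suc N) * S = (\<Sum>k<Suc N. S)"
    unfolding sum_constant by simp
  also have "\<dots> = (\<Sum>k<Suc N. \<Sum>w\<in>words (Suc N). Const (\<phi> (rotate k w)) * prod_list (map u w))"
    unfolding S_def by (rule sum.cong[OF refl]) (rule rotated)
  also have "\<dots> = (\<Sum>w\<in>words (Suc N). \<Sum>k<Suc N. Const (\<phi> (rotate k w)) * prod_list (map u w))"
    by (rule sum.swap)
  also have "\<dots> = (\<Sum>w\<in>words (Suc N). Const (\<Sum>k<Suc N. \<phi> (rotate k w)) * prod_list (map u w))"
    unfolding Const_sum sum_distrib_right ..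
  also have "Const (1 / real (Suc N)) * \<dots> =
      (\<Sum>w\<in>words (Suc N). Const ((\<Sum>k<Suc N. \<phi> (rotate k w)) / real (Suc N)) * prod_list (map u w))"
    unfolding sum_distrib_left mult.assoc[symmetric] Const_mult by (simp only: times_divide_eq_left mult_1 sum_divide_distrib)
  finally show ?thesis unfolding S_def .
qed

text \<open>Each position of the word comes first in exactly one of its rotations.\<close>

lemma freq_nth_rotate:
  assumes "w \<noteq> []"
  shows "freq w $ l = (\<Sum>k<length w. if hd (rotate k w) = l then 1 else 0) / real (length w)"
proof -
  have "hd (rotate k w) = w ! k" if "k < length w" for k
    using that assms by (simp add: hd_rotate_conv_nth)
  then have "(\<Sum>k<length w. if hd (rotate k w) = l then 1 else 0) =
      (\<Sum>k<length w. if w ! k = l then 1 else (0::real))"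
    by (intro sum.cong) auto
  also have "\<dots> = real (card {k. k < length w \<and> w ! k = l})"
    by (subst sum.inter_filter[symmetric]) (auto simp: lessThan_def Collect_conj_eq)
  also have "\<dots> = real (count_list w l)"
    by (simp add: count_list_eq_length_filter length_filter_conv_card eq_commute)
  finally show ?thesis by (simp add: freq_def)
qed

text \<open>
  Multiplication by one letter prescribes the first letter of a word only. Averaging over the
  rotations of the word turns this constraint into the frequency of that letter.
\<close>

lemma symbol_mult_letter:
  fixes u :: "'l::finite \<Rightarrow> 'n::finite rpoly"
  assumes p: "symbol u D p P"
  shows "symbol u (Suc D) (u l * p) (\<lambda>y. y $ l * P y)"
  unfolding symbol_def
proof (intro conjI allI impI)
  show "continuous_on UNIV (\<lambda>y. y $ l * P y)"
    by (intro continuous_intros symbol_continuous[OF p])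
  fix \<epsilon> :: real assume "\<epsilon> > 0"
  then have e: "\<epsilon> / 2 > 0" by simp
  \<comment> \<open>The ball contains the frequency vectors of all words, so one \<delta> works for
    every length.\<close>
  have "uniformly_continuous_on (cball 0 1) P"
    using symbol_continuous[OF p] by (intro compact_uniformly_continuous) (auto intro: continuous_on_subset)
  then obtain \<delta> where "\<delta> > 0" and
    \<delta>: "\<And>y z. y \<in> cball 0 1 \<Longrightarrow> z \<in> cball 0 1 \<Longrightarrow> dist z y < \<delta> \<Longrightarrow> dist (P z) (P y) < \<epsilon> / 2"
    using e unfolding uniformly_continuous_on_def by metis
  \<comment> \<open>From this length on, dropping one letter moves the frequency vector by less than
    \<delta>.\<close>
  obtain N1 :: nat where N1: "2 / \<delta> < real N1" using reals_Archimedean2 by blast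
  have "\<forall>\<^sub>F N in sequentially. \<exists>\<gamma>.
      word_expansion u ((\<Sum>l\<in>UNIV. u l) ^ (Suc N - Suc D) * (u l * p)) (\<lambda>y. y $ l * P y) \<epsilon> (Suc N) \<gamma>"
    using symbolD[OF p e] eventually_ge_at_top[of N1]
  proof eventually_elim
    case (elim N)
    then obtain \<gamma> where "word_expansion u ((\<Sum>l\<in>UNIV. u l) ^ (N - D) * p) P (\<epsilon> / 2) N \<gamma>" by blast
    then have
      \<gamma>: "(\<Sum>l\<in>UNIV. u l) ^ (N - D) * p = (\<Sum>w\<in>words N. Const (\<gamma> w) * prod_list (map u w))"
        "\<And>w. w \<in> words N \<Longrightarrow> \<bar>\<gamma> w - P (freq w)\<bar> \<le> \<epsilon> / 2"
      by (auto simp: word_expansion_def)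
    \<comment> \<open>Multiplying by \<open>u l\<close> prepends the letter \<open>l\<close>: words
      starting with \<open>l\<close> inherit the coefficient of their tail, all others get
      0.\<close>
    define \<phi> where "\<phi> = (\<lambda>w. if hd w = l then \<gamma> (tl w) else 0)"
    have "word_expansion u ((\<Sum>l\<in>UNIV. u l) ^ (Suc N - Suc D) * (u l * p)) (\<lambda>y. y $ l * P y) \<epsilon> (Suc N)
        (\<lambda>w. (\<Sum>k<Suc N. \<phi> (rotate k w)) / real (Suc N))"
      unfolding word_expansion_def
    proof (intro conjI ballI)
      have "(\<Sum>l\<in>UNIV. u l) ^ (N - D) * (u l * p) = u l * ((\<Sum>l\<in>UNIV. u l) ^ (N - D) * p)"
        by (simp add: ac_simps)
      also have "\<dots> = (\<Sum>w\<in>words N. Const (\<gamma> w) * prod_list (map u (l # w)))"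
        unfolding \<gamma>(1) by (simp add: sum_distrib_left ac_simps)
      also have "\<dots> = (\<Sum>m\<in>UNIV. if m = l then \<Sum>w\<in>words N. Const (\<gamma> w) * prod_list (map u (l # w)) else 0)"
        by simp
      also have "\<dots> = (\<Sum>w\<in>words (Suc N). Const (\<phi> w) * prod_list (map u w))"
        unfolding sum_words_Suc by (intro sum.cong) (auto simp: \<phi>_def)
      finally show "(\<Sum>l\<in>UNIV. u l) ^ (Suc N - Suc D) * (u l * p) =
        (\<Sum>w\<in>words (Suc N). Const ((\<Sum>k<Suc N. \<phi> (rotate k w)) / real (Suc N)) * prod_list (map u w))"
        using symmetrise_words[where u = u and N = N and \<phi> = \<phi>] by (simp del: sum.lessThan_Suc)
    next
      fix w :: "'l list" assume "w \<in> words (Suc N)"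
      then have len: "length w = Suc N" by (simp add: words_def)
      then have "w \<noteq> []" by auto
      have "\<bar>\<phi> (rotate k w) - (if hd (rotate k w) = l then 1 else 0) * P (freq w)\<bar> \<le> \<epsilon>" for k
      proof (cases "hd (rotate k w) = l")
        case True
        define v where "v = tl (rotate k w)"
        have lv: "length v = N" using len by (simp add: v_def)
        have "l # v = rotate k w"
          using True \<open>w \<noteq> []\<close> by (metis hd_Cons_tl rotate_is_Nil_conv v_def)
        then have fr: "freq (l # v) = freq w" by (metis freq_mset_cong mset_rotate)
        have "2 / real (Suc N) < \<delta>"
        proof -
          have "2 / \<delta> < real (Suc N)" using N1 elim(2) by linarith
          then show ?thesis using \<open>\<delta> > 0\<close> by (simp add: field_simps)
        qed
        then have "dist (freq w) (freq v) < \<delta>"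
          using dist_freq_Cons[of l v] lv fr by simp
        then have "dist (P (freq w)) (P (freq v)) < \<epsilon> / 2"
          by (intro \<delta>) (simp_all add: norm_freq_le)
        moreover have "\<bar>\<gamma> v - P (freq v)\<bar> \<le> \<epsilon> / 2" using lv by (intro \<gamma>) (simp add: words_def)
        ultimately have "\<bar>\<gamma> v - P (freq w)\<bar> \<le> \<epsilon>" unfolding dist_real_def by linarith
        then show ?thesis using True by (simp add: \<phi>_def v_def[symmetric])
      next
        case False
        then show ?thesis using \<open>\<epsilon> > 0\<close> by (simp add: \<phi>_def)
      qed
      note bound = this
      \<comment> \<open>Both terms are averages over the rotations of \<open>w\<close>, so the error
        is an average of errors that are each at most \<epsilon>.\<close>
      have "(\<Sum>k<Suc N. \<phi> (rotate k w)) / real (Suc N) - freq w $ l * P (freq w) =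
        (\<Sum>k<Suc N. \<phi> (rotate k w) - (if hd (rotate k w) = l then 1 else 0) * P (freq w)) / real (Suc N)"
        by (subst freq_nth_rotate[OF \<open>w \<noteq> []\<close>])
          (simp del: sum.lessThan_Suc of_nat_Suc add: len sum_subtractf sum_distrib_right[symmetric] diff_divide_distrib)
      also have "\<bar>\<dots>\<bar> \<le> (\<Sum>k<Suc N. \<epsilon>) / real (Suc N)"
        unfolding abs_divide abs_of_nat using bound
        by (intro divide_right_mono order_trans[OF sum_abs] sum_mono) simp_all
      also have "\<dots> = \<epsilon>" by (simp del: sum.lessThan_Suc)
      finally show "\<bar>(\<Sum>k<Suc N. \<phi> (rotate k w)) / real (Suc N) - freq w $ l * P (freq w)\<bar> \<le> \<epsilon>" .
    qed
    then show ?case by blast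
  qed
  then show "\<forall>\<^sub>F N in sequentially. \<exists>\<gamma>.
      word_expansion u ((\<Sum>l\<in>UNIV. u l) ^ (N - Suc D) * (u l * p)) (\<lambda>y. y $ l * P y) \<epsilon> N \<gamma>"
    by (subst (asm) eventually_sequentially_Suc)
qed

section \<open>The Veronese embedding\<close>

text \<open>The factor is chosen so that the squares sum to \<open>sq_norm\<close>: each pair
  contributes (2 X_i^2 + 2 X_j^2) / (4 n), summed over all ordered pairs. The redundancy of the
  index triples, such as the zero root at \<open>(i, i, False)\<close>, does no harm.\<close>

definition letter_root :: "'n::finite \<times> 'n \<times> bool \<Rightarrow> 'n rpoly" where
  "letter_root = (\<lambda>(i, j, s). Const (1 / (2 * sqrt (real CARD('n)))) * (if s then Var i + Var j else Var i - Var j))"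

definition letter :: "'n::finite \<times> 'n \<times> bool \<Rightarrow> 'n rpoly" where
  "letter l = letter_root l ^ 2"

text \<open>By polarisation, (X_i + X_j)^2 - (X_i - X_j)^2 = 4 X_i X_j, so this linear function of
  the letter coordinates stands for the product X_i X_j.\<close>

definition coord :: "'n::finite \<Rightarrow> 'n \<Rightarrow> real ^ ('n \<times> 'n \<times> bool) \<Rightarrow> real" where
  "coord i j y = real CARD('n) * (y $ (i, j, True) - y $ (i, j, False))"

lemma letter_eq:
  "letter (i, j, s) =
    Const (1 / (4 * real CARD('n))) * (if s then Var i + Var j else Var i - Var j :: 'n::finite rpoly) ^ 2"
  by (simp add: letter_def letter_root_def power_mult_distrib Const_power power_divide)

lemma sum_letter: "(\<Sum>l\<in>UNIV. letter l) = (sq_norm :: 'n::finite rpoly)"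
proof -
  define n where "n = real CARD('n)"
  have n: "n > 0" by (simp add: n_def)
  have "(\<Sum>l\<in>UNIV. letter l) = (\<Sum>i\<in>UNIV. \<Sum>j\<in>UNIV. \<Sum>s\<in>UNIV. letter (i :: 'n, j, s))"
    by (simp add: sum.cartesian_product split_def)
  also have "\<dots> = (\<Sum>i\<in>UNIV. \<Sum>j\<in>UNIV. Const (1 / (2 * n)) * (Var (i :: 'n) ^ 2 + Var j ^ 2))"
  proof (intro sum.cong refl)
    fix i j :: 'n
    have "(\<Sum>s\<in>UNIV. letter (i, j, s)) = Const (1 / (4 * n)) * ((Var i - Var j) ^ 2 + (Var i + Var j) ^ 2)"
      by (simp add: UNIV_bool letter_eq n_def distrib_left)
    also have "(Var i - Var j) ^ 2 + (Var i + Var j) ^ 2 = 2 * (Var i ^ 2 + Var j ^ 2)"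
      by (simp add: power2_eq_square algebra_simps)
    also have "(2 :: 'n rpoly) = Const 2" by simp
    also have "Const (1 / (4 * n)) * (Const 2 * (Var i ^ 2 + Var j ^ 2)) =
        (Const (1 / (4 * n)) * Const 2) * (Var i ^ 2 + Var j ^ 2)" by (simp only: mult.assoc)
    also have "Const (1 / (4 * n)) * Const 2 = (Const (1 / (2 * n)) :: 'n rpoly)"
      unfolding Const_mult by simp
    finally show "(\<Sum>s\<in>UNIV. letter (i, j, s)) = Const (1 / (2 * n)) * (Var i ^ 2 + Var j ^ 2)" .
  qed
  also have "\<dots> = Const (1 / (2 * n)) * (\<Sum>i\<in>UNIV. \<Sum>j\<in>UNIV. Var (i :: 'n) ^ 2 + Var j ^ 2)"
    by (simp only: sum_distrib_left)
  also have "(\<Sum>i\<in>UNIV. \<Sum>j\<in>UNIV. Var (i :: 'n) ^ 2 + Var j ^ 2) = of_nat (2 * CARD('n)) * sq_norm"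
    by (simp add: sq_norm_def sum.distrib sum_distrib_left[symmetric])
  also have "of_nat (2 * CARD('n)) = (Const (2 * n) :: 'n rpoly)"
    unfolding single_of_nat[symmetric] by (simp add: n_def)
  also have "Const (1 / (2 * n)) * (Const (2 * n) * sq_norm) = (Const (1 / (2 * n)) * Const (2 * n)) * (sq_norm :: 'n rpoly)"
    by (simp only: mult.assoc)
  also have "\<dots> = sq_norm" unfolding Const_mult using n by simp
  finally show ?thesis .
qed

lemma Var_mult_letters:
  "Var i * Var j = Const (real CARD('n)) * letter (i, j, True) +
     Const (- real CARD('n)) * (letter (i, j, False) :: 'n::finite rpoly)"
proof -
  define n where "n = real CARD('n)"
  have n: "n > 0" by (simp add: n_def)
  have quarter: "Const n * (Const (1 / (4 * n)) * q) = Const (1 / 4) * q"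
    "Const (- n) * (Const (1 / (4 * n)) * q) = - (Const (1 / 4) * q)" for q :: "'n rpoly"
    using n by (simp_all add: mult.assoc[symmetric] Const_mult single_uminus)
  have "Const n * letter (i, j, True) + Const (- n) * (letter (i, j, False) :: 'n rpoly)
    = Const (1 / 4) * ((Var i + Var j) ^ 2 - (Var i - Var j) ^ 2)"
    unfolding letter_eq n_def[symmetric] quarter by (simp add: right_diff_distrib)
  also have "(Var i + Var j) ^ 2 - (Var i - Var j) ^ 2 = (4 * (Var i * Var j) :: 'n rpoly)"
    by (simp add: power2_eq_square algebra_simps)
  also have "(4 :: 'n rpoly) = Const 4" by simp
  also have "Const (1 / 4) * (Const 4 * (Var i * Var j)) = (Const (1 / 4) * Const 4) * (Var i * Var j :: 'n rpoly)"
    by (simp only: mult.assoc)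
  also have "\<dots> = Var i * Var j" unfolding Const_mult by simp
  finally show ?thesis by (simp add: n_def)
qed

section \<open>Symbols of monomials of even degree\<close>

lemma symbol_mult_Vars:
  fixes p :: "'n::finite rpoly"
  assumes "symbol letter D p P"
  shows "symbol letter (Suc D) (Var i * Var j * p) (\<lambda>y. coord i j y * P y)"
proof -
  have "symbol letter (Suc D)
      (Const (real CARD('n)) * (letter (i, j, True) * p) + Const (- real CARD('n)) * (letter (i, j, False) * p))
      (\<lambda>y. real CARD('n) * (y $ (i, j, True) * P y) + - real CARD('n) * (y $ (i, j, False) * P y))"
    by (intro symbol_add symbol_scale symbol_mult_letter assms)
  moreover have "Const (real CARD('n)) * (letter (i, j, True) * p) + Const (- real CARD('n)) * (letter (i, j, False) * p)
      = Var i * Var j * p"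
    unfolding Var_mult_letters[of i j] by (simp only: distrib_right mult.assoc)
  moreover have "(\<lambda>y. real CARD('n) * (y $ (i, j, True) * P y) + - real CARD('n) * (y $ (i, j, False) * P y))
      = (\<lambda>y. coord i j y * P y)"
    by (simp add: coord_def fun_eq_iff algebra_simps)
  ultimately show ?thesis by simp
qed

lemma symbol_diff:
  assumes "symbol u D p P" and "symbol u D q Q"
  shows "symbol u D (p - q) (\<lambda>y. P y - Q y)"
proof -
  have "Const (- 1) * q = - q" by (simp add: single_uminus)
  then show ?thesis using symbol_add[OF assms(1) symbol_scale[OF assms(2), of "-1"]] by simp
qed

lemma symbol_zero: "symbol u D 0 (\<lambda>_. 0)"
  using symbol_scale[OF symbol_mult_letters[OF symbol_one, of u D], of 0] by simp

lemma symbol_sum: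
  assumes "\<And>a. a \<in> A \<Longrightarrow> symbol u D (p a) (P a)"
  shows "symbol u D (\<Sum>a\<in>A. p a) (\<lambda>y. \<Sum>a\<in>A. P a y)"
  using assms
proof (induction A rule: infinite_finite_induct)
  case (insert a A)
  then show ?case using symbol_add[of u D "p a" "P a"] by simp
qed (simp_all add: symbol_zero)

lemma mono_degree_Suc:
  assumes "mono_degree \<alpha> = Suc m"
  obtains i \<beta> where "\<alpha> = Poly_Mapping.single i 1 + \<beta>" and "mono_degree \<beta> = m"
proof -
  obtain i where i: "Poly_Mapping.lookup \<alpha> i \<noteq> 0"
    using assms by (force simp: mono_degree_def)
  have "\<alpha> = Poly_Mapping.single i 1 + (\<alpha> - Poly_Mapping.single i 1)"
    using i by (intro poly_mapping_eqI) (auto simp: lookup_add lookup_minus lookup_single when_def)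
  moreover from this have "mono_degree \<alpha> = 1 + mono_degree (\<alpha> - Poly_Mapping.single i 1)"
    by (metis mono_degree_add mono_degree_single)
  ultimately show ?thesis using that assms by simp
qed

text \<open>Variables are split off in pairs, each pair contributing a factor
  \<open>coord i j\<close>. Different pairings may give different \<open>P\<close>, but all agree at
  those \<open>y\<close> whose coordinates are the products of the entries of a vector
  \<open>x\<close>.\<close>

lemma symbol_monomial:
  assumes "mono_degree \<alpha> = 2 * D"
  shows "\<exists>P. symbol letter D (Poly_Mapping.single \<alpha> 1) P \<and>
    (\<forall>y x. (\<forall>i j. coord i j y = x $ i * x $ j) \<longrightarrow> P y = poly_eval (Poly_Mapping.single \<alpha> 1) x)"
  using assms
proof (induction D arbitrary: \<alpha>)
  case 0
  then have "\<alpha> = 0" by (intro poly_mapping_eqI) (simp add: mono_degree_def)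
  then show ?case using symbol_one[of letter] by (intro exI[of _ "\<lambda>_. 1"]) simp
next
  case (Suc D)
  then have "mono_degree \<alpha> = Suc (Suc (2 * D))" by simp
  then obtain i \<alpha>' where \<alpha>': "\<alpha> = Poly_Mapping.single i 1 + \<alpha>'" "mono_degree \<alpha>' = Suc (2 * D)"
    by (rule mono_degree_Suc)
  then obtain j \<beta> where \<beta>: "\<alpha>' = Poly_Mapping.single j 1 + \<beta>" "mono_degree \<beta> = 2 * D"
    by (elim mono_degree_Suc)
  obtain P where P: "symbol letter D (Poly_Mapping.single \<beta> 1) P"
    "\<And>y x. (\<forall>i j. coord i j y = x $ i * x $ j) \<Longrightarrow> P y = poly_eval (Poly_Mapping.single \<beta> 1) x"
    using Suc.IH[OF \<beta>(2)] by blast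
  have eq: "Poly_Mapping.single \<alpha> 1 = Var i * Var j * Poly_Mapping.single \<beta> 1"
    by (simp add: \<alpha>' \<beta> Var_def mult_single add.assoc)
  show ?case unfolding eq using symbol_mult_Vars[OF P(1), of i j]
    by (intro exI[of _ "\<lambda>y. coord i j y * P y"]) (auto simp: P(2))
qed

text \<open>It vanishes only if the matrix of the \<open>coord i j y\<close> is x x^T for a unit
  vector x. The first square fixes the trace. The others are 2 by 2 minors through a diagonal entry,
  with \<open>coord j k\<close> in place of \<open>coord k j\<close>, which forces symmetry as
  well.\<close>

definition veronese_defect :: "real ^ ('n::finite \<times> 'n \<times> bool) \<Rightarrow> real" where
  "veronese_defect y = ((\<Sum>i\<in>UNIV. coord i i y) - 1) ^ 2 +
    (\<Sum>i\<in>UNIV. \<Sum>j\<in>UNIV. \<Sum>k\<in>UNIV. (coord i j y * coord k k y - coord i k y * coord j k y) ^ 2)"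

lemma veronese_defect_nonneg: "veronese_defect y \<ge> 0"
  unfolding veronese_defect_def by (intro add_nonneg_nonneg sum_nonneg) auto

lemma veronese_defect_eq_0:
  fixes y :: "real ^ ('n::finite \<times> 'n \<times> bool)"
  assumes "veronese_defect y = 0"
  obtains x :: "real ^ 'n" where "norm x = 1" and "\<And>i j. coord i j y = x $ i * x $ j"
proof -
  have "((\<Sum>i\<in>UNIV. coord i i y) - 1) ^ 2 = 0 \<and>
      (\<Sum>i\<in>UNIV. \<Sum>j\<in>UNIV. \<Sum>k\<in>UNIV. (coord i j y * coord k k y - coord i k y * coord j k y) ^ 2) = 0"
    using assms unfolding veronese_defect_def
    by (subst (asm) add_nonneg_eq_0_iff) (auto intro!: sum_nonneg)
  then have trace: "(\<Sum>i\<in>UNIV. coord i i y) = 1"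
    and minor: "\<And>i j k. coord i j y * coord k k y = coord i k y * coord j k y"
    by (auto simp: sum_nonneg_eq_0_iff sum_nonneg)
  have "\<exists>k. coord k k y > 0"
  proof (rule ccontr)
    assume "\<not> ?thesis"
    then have "(\<Sum>i\<in>UNIV. coord i i y) \<le> 0" by (intro sum_nonpos) (simp add: not_less)
    then show False using trace by simp
  qed
  then obtain k where k: "coord k k y > 0" by blast
  \<comment> \<open>A column with positive diagonal entry, rescaled; the minors then say that entry
    i, j is the product of entries i, k and j, k divided by entry k, k.\<close>
  define x :: "real ^ 'n" where "x = (\<chi> i. coord i k y / sqrt (coord k k y))"
  have x: "coord i j y = x $ i * x $ j" for i j
    using minor[of i j k] k by (simp add: x_def field_simps)
  have "(norm x)\<^sup>2 = 1"
    using trace by (simp add: norm_vec_def L2_set_def sum_nonneg x power2_eq_square)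
  then have "norm x = 1" by (simp add: power2_eq_1_iff) (smt (verit) norm_ge_zero)
  then show ?thesis using x that by blast
qed

text \<open>The form \<open>sq_norm * p\<close> has two symbols: one from writing
  \<open>sq_norm\<close> as the sum of the squared variables, one from writing it as the sum of all
  letters. Their difference is a symbol of 0.\<close>

lemma symbol_mult_trace:
  assumes "symbol letter D p P"
  shows "symbol letter (Suc D) 0 (\<lambda>y. ((\<Sum>i\<in>UNIV. coord i i y) - 1) * P y)"
proof -
  have "symbol letter (Suc D) (\<Sum>i\<in>UNIV. Var i * Var i * p) (\<lambda>y. \<Sum>i\<in>UNIV. coord i i y * P y)"
    by (intro symbol_sum symbol_mult_Vars assms)
  moreover have "symbol letter (D + 1) ((\<Sum>l\<in>UNIV. letter l) ^ 1 * p) P"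
    by (intro symbol_mult_letters assms)
  ultimately have "symbol letter (Suc D) ((\<Sum>i\<in>UNIV. Var i * Var i * p) - sq_norm * p)
      (\<lambda>y. (\<Sum>i\<in>UNIV. coord i i y * P y) - P y)"
    by (intro symbol_diff) (simp_all add: sum_letter)
  moreover have "(\<Sum>i\<in>UNIV. Var i * Var i * p) - sq_norm * p = 0"
    by (simp add: sq_norm_def sum_distrib_right power2_eq_square)
  ultimately show ?thesis by (simp add: left_diff_distrib sum_distrib_right)
qed

text \<open>The product of X_i, X_j, X_k, X_k with \<open>p\<close> is paired in two ways; the two
  symbols differ by the minor times \<open>P\<close>.\<close>

lemma symbol_mult_minor:
  assumes "symbol letter D p P"
  shows "symbol letter (Suc (Suc D)) 0 (\<lambda>y. (coord i j y * coord k k y - coord i k y * coord j k y) * P y)"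
proof -
  have "symbol letter (Suc (Suc D)) (Var i * Var j * (Var k * Var k * p) - Var i * Var k * (Var j * Var k * p))
      (\<lambda>y. coord i j y * (coord k k y * P y) - coord i k y * (coord j k y * P y))"
    by (intro symbol_diff symbol_mult_Vars assms)
  moreover have "Var i * Var j * (Var k * Var k * p) - Var i * Var k * (Var j * Var k * p) = 0"
    by (simp add: ac_simps)
  ultimately show ?thesis by (simp add: left_diff_distrib mult.assoc)
qed

text \<open>Multiplying by the same factor twice produces each square. The minors reach letter
  degree 4 in this way.\<close>

lemma symbol_veronese_defect:
  "symbol letter 4 0 (veronese_defect :: real ^ ('a::finite \<times> 'a \<times> bool) \<Rightarrow> real)"
proof -
  have "symbol letter 4 ((\<Sum>i\<in>(UNIV :: 'a set). \<Sum>j\<in>(UNIV :: 'a set). \<Sum>k\<in>(UNIV :: 'a set). 0) + 0) (\<lambda>y :: real ^ ('a \<times> 'a \<times> bool). (\<Sum>i\<in>UNIV. \<Sum>j\<in>UNIV. \<Sum>k\<in>UNIV.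
      (coord i j y * coord k k y - coord i k y * coord j k y) * ((coord i j y * coord k k y - coord i k y * coord j k y) * 1))
      + ((\<Sum>i\<in>UNIV. coord i i y) - 1) * (((\<Sum>i\<in>UNIV. coord i i y) - 1) * 1))"
  proof (intro symbol_add symbol_sum)
    show "symbol letter 4 0 (\<lambda>y :: real ^ ('a \<times> 'a \<times> bool). (coord i j y * coord k k y - coord i k y * coord j k y) *
        ((coord i j y * coord k k y - coord i k y * coord j k y) * 1))" for i j k :: 'a
      using symbol_mult_minor[OF symbol_mult_minor[OF symbol_one]] by (simp add: eval_nat_numeral)
    have "symbol letter 2 0 (\<lambda>y :: real ^ ('a \<times> 'a \<times> bool). ((\<Sum>i\<in>UNIV. coord i i y) - 1) * (((\<Sum>i\<in>UNIV. coord i i y) - 1) * 1))"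
      using symbol_mult_trace[OF symbol_mult_trace[OF symbol_one]] by (simp add: eval_nat_numeral)
    \<comment> \<open>The square of the trace term only has letter degree 2 and is raised to
      4.\<close>
    from symbol_mult_letters[OF this, of 2]
    show "symbol letter 4 0 (\<lambda>y :: real ^ ('a \<times> 'a \<times> bool). ((\<Sum>i\<in>UNIV. coord i i y) - 1) * (((\<Sum>i\<in>UNIV. coord i i y) - 1) * 1))"
      by simp
  qed
  moreover have "(\<lambda>y. (\<Sum>i\<in>UNIV. \<Sum>j\<in>UNIV. \<Sum>k\<in>UNIV.
      (coord i j y * coord k k y - coord i k y * coord j k y) * ((coord i j y * coord k k y - coord i k y * coord j k y) * 1))
      + ((\<Sum>i\<in>UNIV. coord i i y) - 1) * (((\<Sum>i\<in>UNIV. coord i i y) - 1) * 1)) =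
      (veronese_defect :: real ^ ('a \<times> 'a \<times> bool) \<Rightarrow> real)"
    by (simp add: fun_eq_iff veronese_defect_def power2_eq_square)
  ultimately show ?thesis by simp
qed

text \<open>On the compact set where \<open>f\<close> is nonpositive, \<open>g\<close> is positive
  and hence bounded away from 0, so a large multiple of it outweighs \<open>f\<close>. The lemma
  serves both the Veronese defect and the scalar constraints.\<close>

lemma compact_penalty:
  fixes f g :: "'a::metric_space \<Rightarrow> real"
  assumes K: "compact K" and f: "continuous_on K f" and g: "continuous_on K g"
    and g_nonneg: "\<And>x. x \<in> K \<Longrightarrow> g x \<ge> 0" and f_pos: "\<And>x. x \<in> K \<Longrightarrow> g x = 0 \<Longrightarrow> f x > 0"
  obtains c \<epsilon> where "c > 0" and "\<epsilon> > 0" and "\<And>x. x \<in> K \<Longrightarrow> f x + c * g x \<ge> \<epsilon>"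
proof -
  have "\<exists>c>0. \<forall>x\<in>K. f x + c * g x > 0"
  proof -
    define L where "L = K \<inter> f -` {..0}"
    have L: "compact L" unfolding L_def
      using continuous_on_closed_vimage[of K f] K f
      by (metis closed_atMost compact_Int_closed compact_imp_closed inf.left_idem inf_commute)
    show ?thesis
    proof (cases "L = {}")
      case True
      then show ?thesis unfolding L_def using g_nonneg by (intro exI[of _ 1]) (force simp: not_le)
    next
      case False
      obtain a where a: "a \<in> L" "\<And>x. x \<in> L \<Longrightarrow> g a \<le> g x"
        using continuous_attains_inf[OF L False continuous_on_subset[OF g]] by (auto simp: L_def)
      obtain b where b: "b \<in> L" "\<And>x. x \<in> L \<Longrightarrow> f b \<le> f x"
        using continuous_attains_inf[OF L False continuous_on_subset[OF f]] by (auto simp: L_def)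
      have ga: "g a > 0" using a(1) g_nonneg[of a] f_pos[of a] by (force simp: L_def)
      have fb: "f b \<le> 0" using b(1) by (simp add: L_def)
      \<comment> \<open>With this value \<open>f x + c * g x\<close> is at least 1 on
        \<open>L\<close>.\<close>
      define c where "c = (1 - f b) / g a"
      have c: "c > 0" using ga fb by (simp add: c_def)
      have "f x + c * g x > 0" if "x \<in> K" for x
      proof (cases "x \<in> L")
        case True
        have "c * g a \<le> c * g x" using a(2)[OF True] c by simp
        moreover have "c * g a = 1 - f b" using ga by (simp add: c_def)
        ultimately show ?thesis using b(2)[OF True] by linarith
      next
        case False
        then have "f x > 0" using that by (simp add: L_def not_le)
        then show ?thesis using g_nonneg[OF that] c by (simp add: add_pos_nonneg)
      qed
      then show ?thesis using c by blast
    qed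
  qed
  then obtain c where c: "c > 0" "\<And>x. x \<in> K \<Longrightarrow> f x + c * g x > 0" by blast
  show ?thesis
  proof (cases "K = {}")
    case True
    then show ?thesis using that[of 1 1] by simp
  next
    case False
    have "continuous_on K (\<lambda>x. f x + c * g x)" by (intro continuous_intros f g)
    then obtain a where "a \<in> K" "\<And>x. x \<in> K \<Longrightarrow> f a + c * g a \<le> f x + c * g x"
      using continuous_attains_inf[OF K False] by blast
    then show ?thesis using that[of c "f a + c * g a"] c by blast
  qed
qed

section \<open>Matrix cones\<close>

lemma inner_matrix_vector:
  fixes A :: "real ^ 't::finite ^ 't"
  shows "v \<bullet> (A *v w) = (\<Sum>i\<in>UNIV. \<Sum>j\<in>UNIV. v $ i * A $ i $ j * w $ j)"
  by (simp add: inner_vec_def matrix_vector_mult_def sum_distrib_left mult.assoc)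

lemma sym_matrix_entry: "sym_matrix A \<Longrightarrow> A $ i $ j = A $ j $ i"
  unfolding sym_matrix_def transpose_def vec_eq_iff by simp

lemma sym_matrixI: "(\<And>i j. A $ i $ j = A $ j $ i) \<Longrightarrow> sym_matrix A"
  by (simp add: sym_matrix_def transpose_def vec_eq_iff)

lemma sym_matrix_inner:
  fixes A :: "real ^ 't::finite ^ 't"
  assumes "sym_matrix A"
  shows "v \<bullet> (A *v w) = (A *v v) \<bullet> w"
  unfolding dot_lmul_matrix[symmetric] using assms
  by (subst transpose_matrix_vector[symmetric]) (simp only: sym_matrix_def)

lemma quadratic_form_rank_one:
  fixes a v :: "real ^ 't::finite"
  shows "v \<bullet> ((\<chi> i j. a $ i * a $ j) *v v) = (a \<bullet> v) ^ 2"
  unfolding inner_matrix_vector by (simp add: inner_vec_def power2_eq_square sum_product ac_simps)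

text \<open>Splitting off a rank one matrix by a Schur complement clears one row and column.\<close>

lemma pos_semidef_rank_one_sum:
  fixes C :: "real ^ 't::finite ^ 't"
  assumes "pos_semidef C"
  shows "\<exists>(m::nat) a. \<forall>i j. C $ i $ j = (\<Sum>k<m. a k $ i * a k $ j)"
proof -
  \<comment> \<open>Generalised for induction: \<open>S\<close> contains the indices of all rows
    that may be nonzero.\<close>
  have "\<exists>(m::nat) a. \<forall>i j. C $ i $ j = (\<Sum>k<m. a k $ i * a k $ j)"
    if "finite S" "pos_semidef C" "\<And>i j. i \<notin> S \<Longrightarrow> C $ i $ j = 0" for S and C :: "real ^ 't ^ 't"
    using that
  proof (induction S arbitrary: C)
    case empty
    then show ?case by (intro exI[of _ 0]) simp
  next
    case (insert s S)
    note sym = sym_matrix_entry[of C]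
    have symC: "sym_matrix C" and psd: "\<And>v. 0 \<le> v \<bullet> (C *v v)"
      using insert.prems(1) by (auto simp: pos_semidef_def)
    have Cs: "C *v axis s 1 = C $ s"
      by (simp add: matrix_vector_mult_basis column_def vec_eq_iff sym_matrix_entry[OF symC])
    define c where "c = C $ s $ s"
    \<comment> \<open>The form along a line in direction \<open>axis s 1\<close>: a quadratic
      polynomial in \<open>r\<close> with leading coefficient \<open>c\<close>.\<close>
    have shift: "(w - r *\<^sub>R axis s 1) \<bullet> (C *v (w - r *\<^sub>R axis s 1)) =
        w \<bullet> (C *v w) - 2 * r * (C $ s \<bullet> w) + r ^ 2 * c" for w r
    proof -
      have 1: "axis s 1 \<bullet> (C *v w) = C $ s \<bullet> w"
        using sym_matrix_inner[OF symC, of "axis s 1" w] by (simp add: Cs)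
      have 2: "w \<bullet> C $ s = C $ s \<bullet> w" by (rule inner_commute)
      have 3: "axis s 1 \<bullet> C $ s = c" by (simp add: inner_axis' c_def)
      have 4: "C *v (w - r *\<^sub>R axis s 1) = C *v w - r *\<^sub>R C $ s"
        by (simp only: matrix_vector_mult_diff_distrib matrix_vector_mult_scaleR Cs)
      show ?thesis
        unfolding 4 by (simp add: inner_diff_left inner_diff_right 1 2 3 power2_eq_square algebra_simps)
    qed
    have "c \<ge> 0" using psd[of "axis s 1"] by (simp add: Cs inner_axis' c_def)
    show ?case
    proof (cases "c = 0")
      case True
      have "C $ s $ j = 0" for j
      proof (rule ccontr)
        assume ne: "C $ s $ j \<noteq> 0"
        \<comment> \<open>For this \<open>r\<close> the form takes the value -1, as the term with
          \<open>c\<close> drops out.\<close>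
        define r where "r = (C $ j $ j + 1) / (2 * C $ s $ j)"
        have "0 \<le> C $ j $ j - 2 * r * (C $ s $ j)"
          using psd[of "axis j 1 - r *\<^sub>R axis s 1"] True unfolding shift
          by (simp add: matrix_vector_mult_basis column_def inner_axis inner_axis')
        then show False using ne by (simp add: r_def)
      qed
      then have "C $ i $ j = 0" if "i \<notin> S" for i j
        using that insert.prems(2) by (cases "i = s") auto
      from insert.IH[OF insert.prems(1) this] show ?thesis .
    next
      case False
      with \<open>c \<ge> 0\<close> have c: "c > 0" by simp
      \<comment> \<open>Row \<open>s\<close> of the rank one matrix of \<open>a\<close> equals row
        \<open>s\<close> of \<open>C\<close>, so it cancels in \<open>D\<close>.\<close>
      define a where "a = (1 / sqrt c) *\<^sub>R C $ s"
      define D where "D = C - (\<chi> i j. a $ i * a $ j)"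
      have aa: "a $ i * a $ j = C $ s $ i * C $ s $ j / c" for i j
        using c by (simp add: a_def)
      have "pos_semidef D"
        unfolding pos_semidef_def
      proof (intro conjI allI)
        show "sym_matrix D"
          by (intro sym_matrixI) (simp add: D_def sym_matrix_entry[OF symC] mult.commute)
        fix w
        have "w \<bullet> (D *v w) = w \<bullet> (C *v w) - (a \<bullet> w) ^ 2"
          by (simp add: D_def matrix_vector_mult_diff_rdistrib inner_diff_right quadratic_form_rank_one)
        also have "(a \<bullet> w) ^ 2 = (C $ s \<bullet> w) ^ 2 / c"
          using c by (simp add: a_def power_divide)
        \<comment> \<open>The form of \<open>D\<close> at \<open>w\<close> is the form of
          \<open>C\<close> at the point of the line where the latter is minimal.\<close>
        also have "w \<bullet> (C *v w) - (C $ s \<bullet> w) ^ 2 / c =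
            w \<bullet> (C *v w) - 2 * ((C $ s \<bullet> w) / c) * (C $ s \<bullet> w) + ((C $ s \<bullet> w) / c) ^ 2 * c"
          using c by (simp add: field_simps power2_eq_square)
        also have "\<dots> \<ge> 0" unfolding shift[symmetric] by (rule psd)
        finally show "0 \<le> w \<bullet> (D *v w)" .
      qed
      moreover have "D $ i $ j = 0" if "i \<notin> S" for i j
      proof (cases "i = s")
        case True
        then show ?thesis using c by (simp add: D_def aa c_def)
      next
        case False
        then have "C $ i $ j = 0" "C $ s $ i = 0"
          using that insert.prems(2) sym_matrix_entry[OF symC, of s i] by auto
        then show ?thesis by (simp add: D_def aa)
      qed
      ultimately have "\<exists>(m::nat) b. \<forall>i j. D $ i $ j = (\<Sum>k<m. b k $ i * b k $ j)"
        by (rule insert.IH)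
      then obtain m :: nat and b where b: "\<forall>i j. D $ i $ j = (\<Sum>k<m. b k $ i * b k $ j)"
        by (elim exE)
      have "C $ i $ j = (\<Sum>k<Suc m. (b(m := a)) k $ i * (b(m := a)) k $ j)" for i j
      proof -
        have "C $ i $ j = D $ i $ j + a $ i * a $ j" by (simp add: D_def)
        then show ?thesis by (simp add: b)
      qed
      then show ?thesis by (intro exI[of _ "Suc m"] exI[of _ "b(m := a)"]) blast
    qed
  qed
  from this[of UNIV C] assms show ?thesis by simp
qed

text \<open>Concatenates two indexed families; this gives closure under addition for all sets
  defined by finite sums.\<close>

lemma sum_lessThan_append:
  fixes f g :: "nat \<Rightarrow> 'a::comm_monoid_add"
  shows "(\<Sum>i<m. f i) + (\<Sum>i<k. g i) = (\<Sum>i<m + k. if i < m then f i else g (i - m))"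
  by (induction k) (simp_all add: add.assoc[symmetric])

section \<open>Sums of squares, scalar quadratic modules and matrix cones\<close>

lemma sos_square: "p ^ 2 \<in> sos"
  unfolding sos_def by (rule CollectI, rule exI[of _ 1], rule exI[of _ "\<lambda>_. p"]) simp

lemma sos_0: "0 \<in> sos"
  using sos_square[of 0] by simp

lemma sos_1: "1 \<in> sos"
  using sos_square[of 1] by simp

lemma sos_add:
  assumes "p \<in> sos" and "q \<in> sos"
  shows "p + q \<in> sos"
proof -
  obtain k l :: nat and f g where p: "p = (\<Sum>i<k. f i ^ 2)" and q: "q = (\<Sum>i<l. g i ^ 2)"
    using assms unfolding sos_def by blast
  have "p + q = (\<Sum>i<k + l. (if i < k then f i else g (i - k)) ^ 2)"
    unfolding p q sum_lessThan_append by (intro sum.cong) auto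
  then show ?thesis
    unfolding sos_def by (intro CollectI exI[of _ "k + l"] exI[of _ "\<lambda>i. if i < k then f i else g (i - k)"]) simp
qed

lemma sos_sum: "(\<And>a. a \<in> A \<Longrightarrow> f a \<in> sos) \<Longrightarrow> (\<Sum>a\<in>A. f a) \<in> sos"
  by (induction A rule: infinite_finite_induct) (auto intro: sos_0 sos_add)

lemma sos_mult:
  assumes "p \<in> sos" and "q \<in> sos"
  shows "p * q \<in> sos"
proof -
  obtain k l :: nat and f g where "p = (\<Sum>i<k. f i ^ 2)" and "q = (\<Sum>i<l. g i ^ 2)"
    using assms unfolding sos_def by blast
  then have "p * q = (\<Sum>i<k. \<Sum>j<l. (f i * g j) ^ 2)"
    by (simp add: sum_product power_mult_distrib)
  then show ?thesis by (auto intro!: sos_sum sos_square)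
qed

lemma sos_power: "p \<in> sos \<Longrightarrow> p ^ k \<in> sos"
  by (induction k) (auto intro: sos_1 sos_mult)

lemma sos_sq_norm: "sq_norm \<in> sos"
  unfolding sq_norm_def by (intro sos_sum sos_square)

lemma sos_Const: "c \<ge> 0 \<Longrightarrow> Const c \<in> sos"
  using sos_square[of "Const (sqrt c)"] by (simp add: Const_power)

lemma qmodule_poly_0: "0 \<in> qmodule_poly G"
  unfolding qmodule_poly_def by (rule CollectI, rule exI[of _ 0]) (auto intro!: exI[of _ 0] sos_0)

lemma sos_subset_qmodule_poly: "sos \<subseteq> (qmodule_poly G :: 'n::finite rpoly set)"
proof
  fix p :: "'n rpoly" assume "p \<in> sos"
  then show "p \<in> qmodule_poly G"
    unfolding qmodule_poly_def by (intro CollectI exI[of _ 0] exI[of _ p]) simp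
qed

lemma qmodule_poly_add:
  assumes "p \<in> qmodule_poly G" and "q \<in> qmodule_poly G"
  shows "p + q \<in> qmodule_poly G"
proof -
  obtain m s0 s f where p: "p = s0 + (\<Sum>i<(m::nat). s i * f i)" "s0 \<in> sos" "\<forall>i<m. s i \<in> sos \<and> f i \<in> G"
    using assms(1) unfolding qmodule_poly_def by blast
  obtain k t0 t g where q: "q = t0 + (\<Sum>i<(k::nat). t i * g i)" "t0 \<in> sos" "\<forall>i<k. t i \<in> sos \<and> g i \<in> G"
    using assms(2) unfolding qmodule_poly_def by blast
  have "p + q = (s0 + t0) + ((\<Sum>i<m. s i * f i) + (\<Sum>i<k. t i * g i))"
    by (simp add: p q ac_simps)
  also have "(\<Sum>i<m. s i * f i) + (\<Sum>i<k. t i * g i) =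
      (\<Sum>i<m + k. (if i < m then s i else t (i - m)) * (if i < m then f i else g (i - m)))"
    unfolding sum_lessThan_append by (intro sum.cong) auto
  finally show ?thesis
    unfolding qmodule_poly_def
    by (intro CollectI exI[of _ "m + k"] exI[of _ "s0 + t0"] exI[of _ "\<lambda>i. if i < m then s i else t (i - m)"]
      exI[of _ "\<lambda>i. if i < m then f i else g (i - m)"]) (use p q in \<open>auto intro: sos_add\<close>)
qed

lemma qmodule_poly_sum: "(\<And>a. a \<in> A \<Longrightarrow> f a \<in> qmodule_poly G) \<Longrightarrow> (\<Sum>a\<in>A. f a) \<in> qmodule_poly G"
  by (induction A rule: infinite_finite_induct) (auto intro: qmodule_poly_0 qmodule_poly_add)

lemma qmodule_poly_generator: "s \<in> sos \<Longrightarrow> g \<in> G \<Longrightarrow> s * g \<in> qmodule_poly G"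
  unfolding qmodule_poly_def
  by (intro CollectI exI[of _ 1] exI[of _ 0] exI[of _ "\<lambda>_. s"] exI[of _ "\<lambda>_. g"]) (simp add: sos_0)

lemma qmodule_poly_mult_sos:
  assumes "s \<in> sos" and "p \<in> qmodule_poly G"
  shows "s * p \<in> qmodule_poly G"
proof -
  obtain m s0 t f where p: "p = s0 + (\<Sum>i<(m::nat). t i * f i)" "s0 \<in> sos" "\<forall>i<m. t i \<in> sos \<and> f i \<in> G"
    using assms(2) unfolding qmodule_poly_def by blast
  have "s * p = s * s0 + (\<Sum>i<m. (s * t i) * f i)"
    by (simp add: p distrib_left sum_distrib_left mult.assoc)
  also have "\<dots> \<in> qmodule_poly G"
  proof (intro qmodule_poly_add qmodule_poly_sum)
    show "s * s0 \<in> qmodule_poly G"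
      using sos_subset_qmodule_poly sos_mult[OF assms(1) p(2)] by blast
    show "s * t i * f i \<in> qmodule_poly G" if "i \<in> {..<m}" for i
      using that p(3) assms(1) by (intro qmodule_poly_generator sos_mult) auto
  qed
  finally show ?thesis .
qed

lemma matrix_cone_0: "0 \<in> matrix_cone M"
  unfolding matrix_cone_def by (rule CollectI, rule exI[of _ 0]) auto

lemma matrix_cone_add:
  fixes P Q :: "('n::finite, 't::finite) pmat"
  assumes "P \<in> matrix_cone M" and "Q \<in> matrix_cone M"
  shows "P + Q \<in> matrix_cone M"
proof -
  obtain k \<mu> and A :: "nat \<Rightarrow> ('n, 't) pmat" where
    P: "P = (\<Sum>i<k. scale_pmat (\<mu> i) (transpose (A i) ** A i))" "\<forall>i<k. \<mu> i \<in> M"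
    using assms(1) unfolding matrix_cone_def by blast
  obtain l \<nu> and B :: "nat \<Rightarrow> ('n, 't) pmat" where
    Q: "Q = (\<Sum>i<l. scale_pmat (\<nu> i) (transpose (B i) ** B i))" "\<forall>i<l. \<nu> i \<in> M"
    using assms(2) unfolding matrix_cone_def by blast
  let ?\<mu> = "\<lambda>i. if i < k then \<mu> i else \<nu> (i - k)" and ?A = "\<lambda>i. if i < k then A i else B (i - k)"
  have "P + Q = (\<Sum>i<k + l. scale_pmat (?\<mu> i) (transpose (?A i) ** ?A i))"
    unfolding P(1) Q(1) sum_lessThan_append by (intro sum.cong) auto
  moreover have "\<forall>i<k + l. ?\<mu> i \<in> M" using P(2) Q(2) by auto
  ultimately show ?thesis
    unfolding matrix_cone_def by (intro CollectI exI[of _ "k + l"] exI[of _ ?\<mu>] exI[of _ ?A]) blast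
qed

lemma matrix_cone_sum:
  "(\<And>a. a \<in> I \<Longrightarrow> f a \<in> matrix_cone M) \<Longrightarrow> (\<Sum>a\<in>I. f a) \<in> matrix_cone M"
  by (induction I rule: infinite_finite_induct) (auto intro: matrix_cone_0 matrix_cone_add)

lemma matrix_cone_generator:
  fixes A :: "('n::finite, 't::finite) pmat"
  shows "\<mu> \<in> M \<Longrightarrow> scale_pmat \<mu> (transpose A ** A) \<in> matrix_cone M"
  unfolding matrix_cone_def
  by (intro CollectI exI[of _ 1] exI[of _ "\<lambda>_. \<mu>"] exI[of _ "\<lambda>_. A"]) simp

lemma matrix_cone_mono: "M \<subseteq> M' \<Longrightarrow> matrix_cone M \<subseteq> matrix_cone M'"
  unfolding matrix_cone_def by blast

lemma scale_pmat_nth [simp]: "scale_pmat p A $ i $ j = p * A $ i $ j"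
  by (simp add: scale_pmat_def)

lemma pmat_eval_nth [simp]: "pmat_eval A x $ i $ j = poly_eval (A $ i $ j) x"
  by (simp add: pmat_eval_def)

text \<open>\<open>C\<close> is a sum of rank one matrices a a^T, and each of these is A^T A for the
  matrix A whose only nonzero row is a.\<close>

lemma matrix_cone_pos_semidef:
  fixes C :: "real ^ 't::finite ^ 't" and \<mu> :: "'n::finite rpoly"
  assumes "pos_semidef C" and "\<mu> \<in> M"
  shows "scale_pmat \<mu> (map_matrix Const C) \<in> matrix_cone M"
proof -
  obtain m :: nat and a where a: "\<And>i j. C $ i $ j = (\<Sum>k<m. a k $ i * a k $ j)"
    using pos_semidef_rank_one_sum[OF assms(1)] by blast
  \<comment> \<open>\<open>undefined\<close> is just some fixed row index.\<close>
  define A :: "nat \<Rightarrow> ('n, 't) pmat" where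
    "A k = (\<chi> i j. if i = undefined then Const (a k $ j) else 0)" for k
  have "scale_pmat \<mu> (map_matrix Const C) = (\<Sum>k<m. scale_pmat \<mu> (transpose (A k) ** A k))"
    by (simp add: vec_eq_iff sum_component matrix_matrix_mult_def transpose_def A_def a
      Const_sum Const_mult sum_distrib_left if_distrib if_distribR sum.delta cong: if_cong)
  also have "\<dots> \<in> matrix_cone M" using assms(2) by (intro matrix_cone_sum matrix_cone_generator)
  finally show ?thesis .
qed

section \<open>Positive definite forms\<close>

definition coeff_matrix :: "('n::finite, 't::finite) pmat \<Rightarrow> 'n mono \<Rightarrow> real ^ 't ^ 't" where
  "coeff_matrix A \<alpha> = map_matrix (\<lambda>p. Poly_Mapping.lookup p \<alpha>) A"

lemma coeff_matrix_nth [simp]: "coeff_matrix A \<alpha> $ i $ j = Poly_Mapping.lookup (A $ i $ j) \<alpha>"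
  by (simp add: coeff_matrix_def)

lemma matrix_vector_mult_sum_scaleR:
  fixes A :: "'a \<Rightarrow> real ^ 's::finite ^ 't::finite"
  shows "(\<Sum>a\<in>S. c a *\<^sub>R A a) *v v = (\<Sum>a\<in>S. c a *\<^sub>R (A a *v v))"
  by (induction S rule: infinite_finite_induct)
    (simp_all add: matrix_vector_mult_add_rdistrib scaleR_matrix_vector_assoc)

lemma pmat_eval_expand:
  assumes "finite S" and "\<And>i j. Poly_Mapping.keys (A $ i $ j) \<subseteq> S"
  shows "pmat_eval A x = (\<Sum>\<alpha>\<in>S. poly_eval (Poly_Mapping.single \<alpha> 1) x *\<^sub>R coeff_matrix A \<alpha>)"
  using assms
  by (simp add: vec_eq_iff sum_component poly_eval_superset[of S] poly_eval_single mult.commute)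

lemma quadratic_form_bound:
  fixes A :: "real ^ 't::finite ^ 't"
  obtains B where "B \<ge> 0" and "\<And>v. norm v = 1 \<Longrightarrow> \<bar>v \<bullet> (A *v v)\<bar> \<le> B"
proof
  show "0 \<le> onorm ((*v) A)" by (rule onorm_pos_le) simp
  fix v :: "real ^ 't" assume "norm v = 1"
  then show "\<bar>v \<bullet> (A *v v)\<bar> \<le> onorm ((*v) A)"
    using Cauchy_Schwarz_ineq2[of v "A *v v"] onorm[of "(*v) A" v] by simp
qed

lemma quadratic_form_sgn:
  fixes A :: "real ^ 't::finite ^ 't"
  shows "v \<bullet> (A *v v) = (norm v)\<^sup>2 * (sgn v \<bullet> (A *v sgn v))"
proof -
  have "(r *\<^sub>R w) \<bullet> (A *v (r *\<^sub>R w)) = r\<^sup>2 * (w \<bullet> (A *v w))" for r w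
    by (simp add: matrix_vector_mult_scaleR power2_eq_square)
  from this[of "norm v" "sgn v"] show ?thesis
    by (cases "v = 0") (simp_all add: sgn_div_norm)
qed

lemma pos_semidef_unit:
  fixes A :: "real ^ 't::finite ^ 't"
  assumes "sym_matrix A" and "\<And>v. norm v = 1 \<Longrightarrow> 0 \<le> v \<bullet> (A *v v)"
  shows "pos_semidef A"
  unfolding pos_semidef_def
proof (intro conjI allI assms(1))
  fix v :: "real ^ 't"
  show "0 \<le> v \<bullet> (A *v v)"
    unfolding quadratic_form_sgn[of v]
    by (cases "v = 0") (auto intro!: mult_nonneg_nonneg assms(2) simp: norm_sgn)
qed

lemma pos_def_unit:
  fixes A :: "real ^ 't::finite ^ 't"
  assumes "sym_matrix A" and "\<And>v. norm v = 1 \<Longrightarrow> 0 < v \<bullet> (A *v v)"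
  shows "pos_def A"
  unfolding pos_def_def
proof (intro conjI allI impI assms(1))
  fix v :: "real ^ 't" assume "v \<noteq> 0"
  then show "0 < v \<bullet> (A *v v)"
    unfolding quadratic_form_sgn[of v] by (intro mult_pos_pos assms(2)) (auto simp: norm_sgn)
qed

lemma prod_list_letter_sos: "prod_list (map letter w) \<in> sos"
  by (induction w) (auto simp: letter_def intro: sos_1 sos_mult sos_square)

lemma symbol_letters_mult: "symbol letter D p P \<Longrightarrow> symbol letter (D + k) (sq_norm ^ k * p) P"
  using symbol_mult_letters[of letter D p P k] by (simp add: sum_letter)

text \<open>
  The symbol of \<open>H\<close> is positive definite only on the Veronese variety, that is, at the letter
  frequencies which come from points of the sphere. Off the variety a multiple of the defect,
  which is a symbol of the zero form, makes up for this.
\<close>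

theorem pos_def_form_in_matrix_cone:
  fixes H :: "('n::finite, 't::finite) pmat"
  assumes sym: "sym_matrix H" and hom: "homogeneous_pmat (2 * D) H"
    and pd: "\<And>x. norm x = 1 \<Longrightarrow> pos_def (pmat_eval H x)"
  shows "\<exists>N. scale_pmat (sq_norm ^ N) H \<in> matrix_cone sos"
proof -
  define S where "S = {\<alpha> :: 'n mono. mono_degree \<alpha> = 2 * D}"
  have finS: "finite S" unfolding S_def by (rule finite_mono_degree)
  have keys: "Poly_Mapping.keys (H $ i $ j) \<subseteq> S" for i j
    using hom by (auto simp: homogeneous_pmat_iff homogeneous_poly_def S_def)
  define C where "C = coeff_matrix H"
  have "\<forall>\<alpha>\<in>S. \<exists>P. symbol letter D (Poly_Mapping.single \<alpha> 1) P \<and>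
      (\<forall>y x. (\<forall>i j. coord i j y = x $ i * x $ j) \<longrightarrow> P y = poly_eval (Poly_Mapping.single \<alpha> 1) x)"
    unfolding S_def using symbol_monomial by blast
  then obtain P where P: "\<And>\<alpha>. \<alpha> \<in> S \<Longrightarrow> symbol letter D (Poly_Mapping.single \<alpha> 1) (P \<alpha>)"
    and P_eval: "\<And>\<alpha> y x. \<alpha> \<in> S \<Longrightarrow> \<forall>i j. coord i j y = x $ i * x $ j \<Longrightarrow>
      P \<alpha> y = poly_eval (Poly_Mapping.single \<alpha> 1) x"
    unfolding bchoice_iff by blast
  \<comment> \<open>The quadratic form in \<open>v\<close> of the matrix of symbols of the entries
    of \<open>H\<close>.\<close>
  define Q where "Q = (\<lambda>(y, v :: real ^ 't). \<Sum>\<alpha>\<in>S. P \<alpha> y * (v \<bullet> (C \<alpha> *v v)))"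
  define K where "K = cball (0 :: real ^ ('n \<times> 'n \<times> bool)) 1 \<times> sphere (0 :: real ^ 't) 1"
  have "compact K" unfolding K_def by (intro compact_Times compact_cball compact_sphere)
  moreover have "continuous_on K Q"
    unfolding Q_def case_prod_unfold
  proof (intro continuous_intros)
    fix \<alpha> assume "\<alpha> \<in> S"
    then have "continuous_on UNIV (P \<alpha>)" using P symbol_continuous by blast
    then show "continuous_on K (\<lambda>x. P \<alpha> (fst x))"
      by (rule continuous_on_compose2) (auto intro: continuous_intros)
    have "continuous_on UNIV ((*v) (C \<alpha>))" by (intro linear_continuous_on) simp
    then show "continuous_on K (\<lambda>x. C \<alpha> *v snd x)"
      by (rule continuous_on_compose2) (auto intro: continuous_intros)
  qed
  moreover have "continuous_on K (\<lambda>x. veronese_defect (fst x))"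
    by (rule continuous_on_compose2[OF symbol_continuous[OF symbol_veronese_defect]])
      (auto intro: continuous_intros)
  \<comment> \<open>Where the defect vanishes, the symbols take the values of the monomials at a
    point \<open>z\<close> of the sphere, so \<open>Q\<close> is the form of \<open>H\<close> at
    \<open>z\<close>.\<close>
  moreover have "Q x > 0" if x: "x \<in> K" "veronese_defect (fst x) = 0" for x
  proof -
    obtain z where z: "norm z = 1" "\<And>i j. coord i j (fst x) = z $ i * z $ j"
      using veronese_defect_eq_0[OF x(2)] by blast
    define v where "v = snd x"
    have "v \<noteq> 0" using x(1) by (auto simp: K_def v_def)
    have "Q x = (\<Sum>\<alpha>\<in>S. poly_eval (Poly_Mapping.single \<alpha> 1) z * (v \<bullet> (C \<alpha> *v v)))"
      unfolding Q_def case_prod_unfold v_def using z by (intro sum.cong refl) (simp add: P_eval)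
    also have "\<dots> = v \<bullet> (pmat_eval H z *v v)"
      unfolding pmat_eval_expand[OF finS keys] matrix_vector_mult_sum_scaleR
      by (simp add: inner_sum_right C_def)
    also have "\<dots> > 0" using pd[OF z(1)] \<open>v \<noteq> 0\<close> by (simp add: pos_def_def)
    finally show ?thesis .
  qed
  ultimately obtain c \<epsilon> where c: "c > 0" and \<epsilon>: "\<epsilon> > 0"
    and bound: "\<And>x. x \<in> K \<Longrightarrow> Q x + c * veronese_defect (fst x) \<ge> \<epsilon>"
    using compact_penalty[of K Q "\<lambda>x. veronese_defect (fst x)"] veronese_defect_nonneg by metis
  have "\<forall>\<alpha>. \<exists>B\<ge>0. \<forall>v. norm v = 1 \<longrightarrow> \<bar>v \<bullet> (C \<alpha> *v v)\<bar> \<le> B"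
    using quadratic_form_bound by metis
  then obtain B where B: "\<And>\<alpha>. B \<alpha> \<ge> 0" "\<And>\<alpha> v. norm v = 1 \<Longrightarrow> \<bar>v \<bullet> (C \<alpha> *v v)\<bar> \<le> B \<alpha>"
    by metis
  \<comment> \<open>Replacing all symbols by word coefficients of accuracy \<delta> then costs at
    most \<epsilon> in total.\<close>
  define \<delta> where "\<delta> = \<epsilon> / ((\<Sum>\<alpha>\<in>S. B \<alpha>) + c)"
  have Bc: "(\<Sum>\<alpha>\<in>S. B \<alpha>) + c > 0" using B c by (simp add: add_nonneg_pos sum_nonneg)
  then have \<delta>: "\<delta> > 0" using \<epsilon> by (simp add: \<delta>_def)
  \<comment> \<open>Common letter degree: the monomials have \<open>D\<close> and are multiplied by
    \<open>sq_norm ^ 4\<close>, the defect has 4 and is raised by \<open>D\<close>.\<close>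
  let ?D = "D + 4"
  have "\<forall>\<^sub>F N in sequentially. \<forall>\<alpha>\<in>S. \<exists>\<gamma>.
      word_expansion letter (sq_norm ^ (N - ?D) * (sq_norm ^ 4 * Poly_Mapping.single \<alpha> 1)) (P \<alpha>) \<delta> N \<gamma>"
    using symbolD[OF symbol_letters_mult[OF P] \<delta>]
    by (intro eventually_ball_finite finS) (simp add: sum_letter)
  moreover have "\<forall>\<^sub>F N in sequentially. \<exists>\<gamma>.
      word_expansion letter (sq_norm ^ (N - (4 + D)) * (sq_norm ^ D * 0)) (veronese_defect :: real ^ ('n \<times> 'n \<times> bool) \<Rightarrow> real) \<delta> N \<gamma>"
    using symbolD[OF symbol_letters_mult[OF symbol_veronese_defect] \<delta>] by (simp add: sum_letter)
  ultimately have "\<forall>\<^sub>F N in sequentially.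
      (\<forall>\<alpha>\<in>S. \<exists>\<gamma>. word_expansion letter (sq_norm ^ (N - ?D) * (sq_norm ^ 4 * Poly_Mapping.single \<alpha> 1)) (P \<alpha>) \<delta> N \<gamma>) \<and>
      (\<exists>\<gamma>. word_expansion letter (0 :: 'n rpoly) veronese_defect \<delta> N \<gamma>)"
    by eventually_elim simp
  then obtain N where
    "\<forall>\<alpha>\<in>S. \<exists>\<gamma>. word_expansion letter (sq_norm ^ (N - ?D) * (sq_norm ^ 4 * Poly_Mapping.single \<alpha> 1)) (P \<alpha>) \<delta> N \<gamma>"
    and "\<exists>\<gamma>. word_expansion letter (0 :: 'n rpoly) veronese_defect \<delta> N \<gamma>"
    unfolding eventually_sequentially by blast
  then obtain \<gamma> \<eta> where
    \<gamma>: "\<And>\<alpha>. \<alpha> \<in> S \<Longrightarrow> word_expansion letter (sq_norm ^ (N - ?D) * (sq_norm ^ 4 * Poly_Mapping.single \<alpha> 1)) (P \<alpha>) \<delta> N (\<gamma> \<alpha>)"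
    and \<eta>: "word_expansion letter (0 :: 'n rpoly) veronese_defect \<delta> N \<eta>"
    unfolding bchoice_iff by blast
  \<comment> \<open>The coefficient matrix of the word \<open>w\<close>. Its last summand comes from
    an expansion of the zero polynomial, so it changes the coefficients but not the form they
    represent.\<close>
  define M where "M w = (\<Sum>\<alpha>\<in>S. \<gamma> \<alpha> w *\<^sub>R C \<alpha>) + (c * \<eta> w) *\<^sub>R mat 1" for w
  have M_nth: "M w $ i $ j = (\<Sum>\<alpha>\<in>S. \<gamma> \<alpha> w * C \<alpha> $ i $ j) + c * \<eta> w * (mat 1 $ i $ j)" for w i j
    by (simp add: M_def sum_component)
  have psd: "pos_semidef (M w)" if w: "w \<in> words N" for w
  proof (rule pos_semidef_unit)
    show "sym_matrix (M w)"
    proof (rule sym_matrixI)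
      fix i j
      have "C \<alpha> $ i $ j = C \<alpha> $ j $ i" for \<alpha>
        by (simp add: C_def sym_matrix_entry[OF sym, of i j])
      then show "M w $ i $ j = M w $ j $ i" by (simp add: M_nth mat_def)
    qed
    fix v :: "real ^ 't" assume v: "norm v = 1"
    then have vv: "v \<bullet> v = 1" by (simp add: dot_square_norm)
    have "\<epsilon> \<le> (\<Sum>\<alpha>\<in>S. P \<alpha> (freq w) * (v \<bullet> (C \<alpha> *v v))) + c * veronese_defect (freq w)"
      using bound[of "(freq w, v)"] v by (simp add: K_def Q_def norm_freq_le)
    also have "\<dots> \<le> (\<Sum>\<alpha>\<in>S. \<gamma> \<alpha> w * (v \<bullet> (C \<alpha> *v v)) + \<delta> * B \<alpha>) + (c * \<eta> w + c * \<delta>)"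
    proof (intro add_mono sum_mono)
      fix \<alpha> assume "\<alpha> \<in> S"
      then have "\<bar>\<gamma> \<alpha> w - P \<alpha> (freq w)\<bar> \<le> \<delta>" using \<gamma> w by (simp add: word_expansion_def)
      then have "\<bar>(\<gamma> \<alpha> w - P \<alpha> (freq w)) * (v \<bullet> (C \<alpha> *v v))\<bar> \<le> \<delta> * B \<alpha>"
        unfolding abs_mult using B v \<delta> by (intro mult_mono) auto
      then show "P \<alpha> (freq w) * (v \<bullet> (C \<alpha> *v v)) \<le> \<gamma> \<alpha> w * (v \<bullet> (C \<alpha> *v v)) + \<delta> * B \<alpha>"
        by (simp add: left_diff_distrib abs_le_iff)
    next
      have "\<bar>\<eta> w - veronese_defect (freq w)\<bar> \<le> \<delta>" using \<eta> w by (simp add: word_expansion_def)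
      then have "veronese_defect (freq w) \<le> \<eta> w + \<delta>" by linarith
      then show "c * veronese_defect (freq w) \<le> c * \<eta> w + c * \<delta>"
        using c by (metis distrib_left mult_left_mono less_imp_le)
    qed
    also have "\<dots> = v \<bullet> (M w *v v) + \<delta> * ((\<Sum>\<alpha>\<in>S. B \<alpha>) + c)"
      unfolding M_def matrix_vector_mult_add_rdistrib matrix_vector_mult_sum_scaleR
      by (simp add: inner_add_right inner_sum_right scaleR_matrix_vector_assoc[symmetric] vv sum.distrib
        sum_distrib_left distrib_left mult.commute)
    also have "\<delta> * ((\<Sum>\<alpha>\<in>S. B \<alpha>) + c) = \<epsilon>" using Bc by (simp add: \<delta>_def)
    finally show "0 \<le> v \<bullet> (M w *v v)" by simp
  qed
  have "scale_pmat (sq_norm ^ (N - ?D) * sq_norm ^ 4) H =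
      (\<Sum>w\<in>words N. scale_pmat (prod_list (map letter w)) (map_matrix Const (M w)))"
  proof -
    have "sq_norm ^ (N - ?D) * sq_norm ^ 4 * H $ i $ j =
        (\<Sum>w\<in>words N. prod_list (map letter w) * Const (M w $ i $ j))" for i j
    proof -
      define q :: "'n rpoly" where "q = sq_norm ^ (N - ?D) * sq_norm ^ 4"
      have \<gamma>': "q * Poly_Mapping.single \<alpha> 1 = (\<Sum>w\<in>words N. Const (\<gamma> \<alpha> w) * prod_list (map letter w))"
        if "\<alpha> \<in> S" for \<alpha>
        using \<gamma>[OF that] by (simp add: word_expansion_def q_def mult.assoc)
      have \<eta>': "0 = (\<Sum>w\<in>words N. Const (\<eta> w) * (prod_list (map letter w) :: 'n rpoly))"
        using \<eta> by (simp add: word_expansion_def)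
      have "q * H $ i $ j = q * (\<Sum>\<alpha>\<in>S. Poly_Mapping.single \<alpha> (C \<alpha> $ i $ j))"
        unfolding C_def coeff_matrix_nth using rpoly_expand[OF finS keys] by simp
      also have "\<dots> = (\<Sum>\<alpha>\<in>S. Const (C \<alpha> $ i $ j) * (q * Poly_Mapping.single \<alpha> 1))"
        unfolding sum_distrib_left by (intro sum.cong refl) (simp add: mult.left_commute mult_single)
      also have "\<dots> = (\<Sum>\<alpha>\<in>S. Const (C \<alpha> $ i $ j) * (\<Sum>w\<in>words N. Const (\<gamma> \<alpha> w) * prod_list (map letter w)))"
        by (intro sum.cong refl) (simp add: \<gamma>')
      also have "\<dots> = (\<Sum>\<alpha>\<in>S. \<Sum>w\<in>words N. Const (C \<alpha> $ i $ j * \<gamma> \<alpha> w) * prod_list (map letter w))"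
        unfolding sum_distrib_left Const_mult_left ..
      also have "\<dots> = (\<Sum>w\<in>words N. \<Sum>\<alpha>\<in>S. Const (C \<alpha> $ i $ j * \<gamma> \<alpha> w) * prod_list (map letter w))"
        by (rule sum.swap)
      \<comment> \<open>The added sum over words is zero; it supplies the penalty part of
        \<open>M w\<close>.\<close>
      also have "\<dots> = \<dots> + Const (c * (mat 1 $ i $ j)) * (\<Sum>w\<in>words N. Const (\<eta> w) * prod_list (map letter w))"
        unfolding \<eta>'[symmetric] by simp
      also have "\<dots> = (\<Sum>w\<in>words N. (\<Sum>\<alpha>\<in>S. Const (C \<alpha> $ i $ j * \<gamma> \<alpha> w) * prod_list (map letter w)) +
          Const (c * (mat 1 $ i $ j) * \<eta> w) * prod_list (map letter w))"
        unfolding sum_distrib_left Const_mult_left sum.distrib ..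
      also have "\<dots> = (\<Sum>w\<in>words N. prod_list (map letter w) * Const (M w $ i $ j))"
      proof (intro sum.cong refl)
        fix w :: "('n \<times> 'n \<times> bool) list"
        have "M w $ i $ j = (\<Sum>\<alpha>\<in>S. C \<alpha> $ i $ j * \<gamma> \<alpha> w) + c * (mat 1 $ i $ j) * \<eta> w"
          unfolding M_nth by (simp add: ac_simps)
        then have "(Const (M w $ i $ j) :: 'n rpoly) = (\<Sum>\<alpha>\<in>S. Const (C \<alpha> $ i $ j * \<gamma> \<alpha> w)) + Const (c * (mat 1 $ i $ j) * \<eta> w)"
          by (simp only: single_add Const_sum)
        then show "(\<Sum>\<alpha>\<in>S. Const (C \<alpha> $ i $ j * \<gamma> \<alpha> w) * prod_list (map letter w)) +
            Const (c * (mat 1 $ i $ j) * \<eta> w) * prod_list (map letter w) = prod_list (map letter w) * Const (M w $ i $ j)"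
          by (simp only: mult.commute[of "prod_list _"] sum_distrib_right distrib_right)
      qed
      finally show ?thesis unfolding q_def .
    qed
    then show ?thesis by (simp add: vec_eq_iff sum_component)
  qed
  also have "\<dots> \<in> matrix_cone sos"
    by (intro matrix_cone_sum matrix_cone_pos_semidef psd prod_list_letter_sos)
  finally show ?thesis by (metis power_add)
qed

section \<open>Scalar constraints\<close>

lemma qmodule_pmat_0: "0 \<in> qmodule_pmat \<G>"
  unfolding qmodule_pmat_def by (rule CollectI, rule exI[of _ 0]) auto

lemma qmodule_pmat_add:
  fixes P Q :: "('n::finite, 't::finite) pmat"
  assumes "P \<in> qmodule_pmat \<G>" and "Q \<in> qmodule_pmat \<G>"
  shows "P + Q \<in> qmodule_pmat \<G>"
proof -
  obtain k :: nat and A H where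
    P: "P = (\<Sum>i<k. transpose (A i) ** H i ** A i)" "\<forall>i<k. H i \<in> insert (mat 1) \<G>"
    using assms(1) unfolding qmodule_pmat_def mem_Collect_eq by (elim exE conjE) (rule that)
  obtain l :: nat and B J where
    Q: "Q = (\<Sum>i<l. transpose (B i) ** J i ** B i)" "\<forall>i<l. J i \<in> insert (mat 1) \<G>"
    using assms(2) unfolding qmodule_pmat_def mem_Collect_eq by (elim exE conjE) (rule that)
  let ?A = "\<lambda>i. if i < k then A i else B (i - k)" and ?H = "\<lambda>i. if i < k then H i else J (i - k)"
  have 1: "P + Q = (\<Sum>i<k + l. transpose (?A i) ** ?H i ** ?A i)"
    unfolding P(1) Q(1) sum_lessThan_append by (intro sum.cong) auto
  have 2: "\<forall>i<k + l. ?H i \<in> insert (mat 1) \<G>"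
  proof (intro allI impI)
    fix i assume "i < k + l"
    then show "?H i \<in> insert (mat 1) \<G>"
      using P(2)[rule_format, of i] Q(2)[rule_format, of "i - k"] by (cases "i < k") auto
  qed
  show ?thesis
    unfolding qmodule_pmat_def by (intro CollectI exI[of _ "k + l"] exI[of _ ?A] exI[of _ ?H] conjI 1 2)
qed

lemma qmodule_pmat_sum:
  "(\<And>a. a \<in> I \<Longrightarrow> f a \<in> qmodule_pmat \<G>) \<Longrightarrow> (\<Sum>a\<in>I. f a) \<in> qmodule_pmat \<G>"
  by (induction I rule: infinite_finite_induct) (auto intro: qmodule_pmat_0 qmodule_pmat_add)

lemma qmodule_pmat_generator:
  assumes "H \<in> insert (mat 1) \<G>"
  shows "transpose A ** H ** A \<in> qmodule_pmat \<G>"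
  unfolding qmodule_pmat_def
  by (intro CollectI exI[of _ 1] exI[of _ "\<lambda>_. A"] exI[of _ "\<lambda>_. H"]) (use assms in simp)

lemma matrix_add_rdistrib: "(A + B) ** C = A ** C + B ** (C :: 'a::semiring_1 ^ 'n ^ 'm)"
  by (simp add: vec_eq_iff matrix_matrix_mult_def distrib_right sum.distrib)

lemma conj_sum:
  fixes P :: "'b \<Rightarrow> ('n::finite, 't::finite) pmat"
  shows "transpose B ** (\<Sum>a\<in>I. P a) ** B = (\<Sum>a\<in>I. transpose B ** P a ** B)"
  by (induction I rule: infinite_finite_induct)
    (simp_all add: matrix_add_ldistrib matrix_add_rdistrib)

lemma qmodule_pmat_conj:
  fixes P :: "('n::finite, 't::finite) pmat"
  assumes "P \<in> qmodule_pmat \<G>"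
  shows "transpose B ** P ** B \<in> qmodule_pmat \<G>"
proof -
  obtain k :: nat and A H where
    P: "P = (\<Sum>i<k. transpose (A i) ** H i ** A i)" "\<forall>i<k. H i \<in> insert (mat 1) \<G>"
    using assms unfolding qmodule_pmat_def mem_Collect_eq by (elim exE conjE) (rule that)
  have "transpose B ** P ** B = (\<Sum>i<k. transpose (A i ** B) ** H i ** (A i ** B))"
    unfolding P(1) conj_sum by (simp only: matrix_transpose_mul matrix_mul_assoc)
  also have "\<dots> \<in> qmodule_pmat \<G>"
    using P(2) by (intro qmodule_pmat_sum qmodule_pmat_generator) simp
  finally show ?thesis .
qed

lemma scale_pmat_mult_left: "scale_pmat p A ** B = scale_pmat p (A ** B)"
  by (simp add: vec_eq_iff matrix_matrix_mult_def sum_distrib_left mult.assoc)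

lemma scale_pmat_mult_right: "A ** scale_pmat p B = scale_pmat p (A ** B)"
  by (simp add: vec_eq_iff matrix_matrix_mult_def sum_distrib_left mult.left_commute)

lemma transpose_scale_pmat: "transpose (scale_pmat p A) = scale_pmat p (transpose A)"
  by (simp add: vec_eq_iff transpose_def)

lemma scale_pmat_scale_pmat: "scale_pmat p (scale_pmat q A) = scale_pmat (p * q) A"
  by (simp add: vec_eq_iff mult.assoc)

lemma conj_scalar_matrix:
  fixes A :: "('n::finite, 't::finite) pmat"
  shows "transpose A ** scale_pmat p (mat 1) ** A = scale_pmat p (transpose A ** A)"
  by (simp only: scale_pmat_mult_left scale_pmat_mult_right matrix_mul_rid)

lemma conj_by_scalar_matrix:
  "transpose (scale_pmat q (mat 1)) ** P ** scale_pmat q (mat 1) = scale_pmat (q ^ 2) P"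
  by (simp only: transpose_scale_pmat scale_pmat_mult_left scale_pmat_mult_right transpose_mat
    matrix_mul_lid matrix_mul_rid scale_pmat_scale_pmat power2_eq_square)

text \<open>Multiplication by a square \<open>q ^ 2\<close> is conjugation by the scalar matrix with
  diagonal entry \<open>q\<close>.\<close>

lemma qmodule_pmat_scale_sos:
  fixes P :: "('n::finite, 't::finite) pmat"
  assumes "P \<in> qmodule_pmat \<G>" and "s \<in> sos"
  shows "scale_pmat s P \<in> qmodule_pmat \<G>"
proof -
  obtain k :: nat and q where s: "s = (\<Sum>i<k. q i ^ 2)"
    using assms(2) unfolding sos_def by blast
  have "scale_pmat s P = (\<Sum>i<k. scale_pmat (q i ^ 2) P)"
    by (simp add: vec_eq_iff sum_component s sum_distrib_right)
  also have "\<dots> \<in> qmodule_pmat \<G>"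
    unfolding conj_by_scalar_matrix[symmetric] by (intro qmodule_pmat_sum qmodule_pmat_conj assms(1))
  finally show ?thesis .
qed

text \<open>The assumption extends from \<open>G\<close> to all \<mu> in
  \<open>qmodule_poly G\<close>, and \<mu> A^T A is the conjugate of the scalar matrix \<mu> I by
  A.\<close>

lemma matrix_cone_subset_qmodule_pmat:
  fixes \<G> :: "('n::finite, 't::finite) pmat set"
  assumes G: "\<And>g. g \<in> G \<Longrightarrow> scale_pmat g (mat 1) \<in> qmodule_pmat \<G>"
  shows "matrix_cone (qmodule_poly G) \<subseteq> qmodule_pmat \<G>"
proof
  have scalar: "scale_pmat \<mu> (mat 1) \<in> qmodule_pmat \<G>" if \<mu>G: "\<mu> \<in> qmodule_poly G" for \<mu>
  proof -
    obtain m :: nat and s0 s f where \<mu>: "\<mu> = s0 + (\<Sum>i<m. s i * f i)" "s0 \<in> sos" "\<forall>i<m. s i \<in> sos \<and> f i \<in> G"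
      using \<mu>G unfolding qmodule_poly_def by blast
    have one: "(mat 1 :: ('n, 't) pmat) \<in> qmodule_pmat \<G>"
      using qmodule_pmat_generator[of "mat 1" \<G> "mat 1"] by simp
    have "scale_pmat \<mu> (mat 1) = scale_pmat s0 (mat 1) + (\<Sum>i<m. scale_pmat (s i) (scale_pmat (f i) (mat 1 :: ('n, 't) pmat)))"
      by (simp add: vec_eq_iff sum_component \<mu>(1) distrib_right sum_distrib_right mult.assoc)
    also have "\<dots> \<in> qmodule_pmat \<G>"
      using \<mu> by (intro qmodule_pmat_add qmodule_pmat_sum qmodule_pmat_scale_sos one G) auto
    finally show ?thesis .
  qed
  fix P :: "('n, 't) pmat" assume "P \<in> matrix_cone (qmodule_poly G)"
  then obtain k :: nat and \<mu> and A :: "nat \<Rightarrow> ('n, 't) pmat" where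
    P: "P = (\<Sum>i<k. scale_pmat (\<mu> i) (transpose (A i) ** A i))" "\<forall>i<k. \<mu> i \<in> qmodule_poly G"
    unfolding matrix_cone_def by blast
  show "P \<in> qmodule_pmat \<G>"
    unfolding P(1) conj_scalar_matrix[symmetric] using P(2)
    by (intro qmodule_pmat_sum qmodule_pmat_conj scalar) simp
qed

section \<open>Scalar forms from matrix constraints, and their use as penalties\<close>

definition quadratic_form_poly :: "('n::finite, 't::finite) pmat \<Rightarrow> real ^ 't \<Rightarrow> 'n rpoly" where
  "quadratic_form_poly A v = (\<Sum>i\<in>UNIV. \<Sum>j\<in>UNIV. Const (v $ i) * A $ i $ j * Const (v $ j))"

lemma poly_eval_quadratic_form_poly:
  "poly_eval (quadratic_form_poly A v) x = v \<bullet> (pmat_eval A x *v v)"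
  by (simp add: quadratic_form_poly_def inner_matrix_vector)

lemma homogeneous_quadratic_form_poly:
  assumes "homogeneous_pmat k A"
  shows "homogeneous_poly k (quadratic_form_poly A v)"
  unfolding quadratic_form_poly_def
proof (intro homogeneous_poly_sum)
  fix i j
  have "homogeneous_poly (0 + k + 0) (Const (v $ i) * A $ i $ j * Const (v $ j))"
    using assms by (intro homogeneous_poly_mult) (simp_all add: homogeneous_pmat_iff)
  then show "homogeneous_poly k (Const (v $ i) * A $ i $ j * Const (v $ j))" by simp
qed

text \<open>
  With \<open>v\<close> placed in column \<open>c\<close> of an otherwise zero matrix \<open>B c\<close>, the only nonzero entry of
  \<open>(B c)\<^sup>T A (B c)\<close> is the diagonal entry \<open>v\<^sup>T A v\<close> at \<open>c\<close>.
\<close>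

lemma quadratic_form_poly_in_qmodule:
  fixes A :: "('n::finite, 't::finite) pmat"
  assumes "A \<in> \<G>"
  shows "scale_pmat (quadratic_form_poly A v) (mat 1) \<in> qmodule_pmat \<G>"
proof -
  define B :: "'t \<Rightarrow> ('n, 't) pmat" where "B c = (\<chi> i j. if j = c then Const (v $ i) else 0)" for c
  have entry: "(transpose (B c) ** A ** B c) $ i $ j =
      (if i = c \<and> j = c then quadratic_form_poly A v else 0)" for c i j
  proof (cases "i = c \<and> j = c")
    case True
    then show ?thesis
      unfolding quadratic_form_poly_def
      by (subst sum.swap) (simp add: matrix_matrix_mult_def transpose_def B_def sum_distrib_right)
  next
    case False
    then show ?thesis by (auto simp: matrix_matrix_mult_def transpose_def B_def)
  qed
  have "scale_pmat (quadratic_form_poly A v) (mat 1) = (\<Sum>c\<in>UNIV. transpose (B c) ** A ** B c)"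
  proof -
    have "quadratic_form_poly A v * (mat 1 :: ('n, 't) pmat) $ i $ j =
        (\<Sum>c\<in>UNIV. if i = c \<and> j = c then quadratic_form_poly A v else 0)" for i j
    proof (cases "i = j")
      case True
      then show ?thesis by (simp add: mat_def)
    next
      case False
      then have "(\<Sum>c\<in>UNIV. if i = c \<and> j = c then quadratic_form_poly A v else 0) = 0"
        by (intro sum.neutral) auto
      then show ?thesis using False by (simp add: mat_def)
    qed
    then show ?thesis by (simp add: vec_eq_iff sum_component entry)
  qed
  also have "\<dots> \<in> qmodule_pmat \<G>"
    using assms by (intro qmodule_pmat_sum qmodule_pmat_generator) simp
  finally show ?thesis .
qed

text \<open>Bernoulli's inequality bounds 1 + m g by (1 + g)^m, and (1 + g)(1 - g) is at most
  1.\<close>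

lemma mult_one_minus_power_le:
  fixes g :: real
  assumes "0 \<le> g" and "g \<le> 1" and "m > 0"
  shows "g * (1 - g) ^ m \<le> 1 / real m"
proof -
  have "(1 + real m * g) * (1 - g) ^ m \<le> (1 + g) ^ m * (1 - g) ^ m"
    using assms Bernoulli_inequality[of g m] by (intro mult_right_mono) (auto simp: mult.commute)
  also have "\<dots> = (1 - g ^ 2) ^ m"
    by (simp add: power_mult_distrib[symmetric] power2_eq_square algebra_simps)
  also have "\<dots> \<le> 1" using assms by (intro power_le_one) (auto simp: power_le_one)
  finally have "(1 - g) ^ m + real m * (g * (1 - g) ^ m) \<le> 1" by (simp add: algebra_simps)
  moreover have "(1 - g) ^ m \<ge> 0" using assms by simp
  ultimately have "real m * (g * (1 - g) ^ m) \<le> 1" by linarith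
  then show ?thesis using assms(3) by (simp add: field_simps)
qed

text \<open>The even power equals (1 - g)^(2k). For nonnegative g the previous bound applies; for
  negative g this factor is at least 1, so the term is at most g.\<close>

lemma penalty_term_le:
  fixes g :: real
  assumes "\<bar>g\<bar> \<le> 1" and "k > 0"
  shows "(g - 1) ^ (2 * k) * g \<le> 1 / real (2 * k) - max 0 (- g)"
proof -
  have even: "(g - 1) ^ (2 * k) = (1 - g) ^ (2 * k)"
    by (simp only: power_mult power2_commute[of g 1])
  show ?thesis
  proof (cases "g \<ge> 0")
    case True
    then show ?thesis
      using mult_one_minus_power_le[of g "2 * k"] assms unfolding even by (simp add: mult.commute)
  next
    case False
    then have "(1 - g) ^ (2 * k) \<ge> 1" by (intro one_le_power) simp
    then have "(1 - g) ^ (2 * k) * g \<le> 1 * g" using False by (intro mult_right_mono_neg) auto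
    moreover have "1 / real (2 * k) \<ge> 0" by simp
    ultimately show ?thesis using False unfolding even by linarith
  qed
qed

text \<open>
  The multipliers \<open>c (g - 1)\<^bsup>2k\<^esup>\<close> punish negative values of \<open>g\<close> and cost at most \<open>c / (2 k)\<close>
  where \<open>g\<close> is nonnegative.
\<close>

lemma penalised_pos_def:
  fixes F :: "('n::finite, 't::finite) pmat"
  assumes G: "finite G" and g_le: "\<And>g x. g \<in> G \<Longrightarrow> norm x = 1 \<Longrightarrow> \<bar>poly_eval g x\<bar> \<le> 1"
    and pd: "\<And>x. norm x = 1 \<Longrightarrow> \<forall>g\<in>G. poly_eval g x \<ge> 0 \<Longrightarrow> pos_def (pmat_eval F x)"
  obtains c k where "c > 0" and "k > 0"
    and "\<And>x v. norm x = 1 \<Longrightarrow> norm v = 1 \<Longrightarrow>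
      v \<bullet> (pmat_eval F x *v v) > c * (\<Sum>g\<in>G. (poly_eval g x - 1) ^ (2 * k) * poly_eval g x)"
proof -
  define K where "K = sphere (0 :: real ^ 'n) 1 \<times> sphere (0 :: real ^ 't) 1"
  define f where "f = (\<lambda>z. snd z \<bullet> (pmat_eval F (fst z) *v (snd z :: real ^ 't)))"
  \<comment> \<open>The total violation of the constraints; it vanishes exactly where all
    \<open>g\<close> in \<open>G\<close> are nonnegative.\<close>
  define r where "r = (\<lambda>z :: (real ^ 'n) \<times> (real ^ 't). \<Sum>g\<in>G. max 0 (- poly_eval g (fst z)))"
  have "compact K" unfolding K_def by (intro compact_Times compact_sphere)
  moreover have "continuous_on K f"
    unfolding f_def inner_matrix_vector pmat_eval_nth by (intro continuous_intros)
  moreover have "continuous_on K r"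
    unfolding r_def by (intro continuous_intros)
  moreover have "r z \<ge> 0" for z unfolding r_def by (intro sum_nonneg) simp
  moreover have "f z > 0" if z: "z \<in> K" "r z = 0" for z
  proof -
    have "\<forall>g\<in>G. max 0 (- poly_eval g (fst z)) = 0"
      using z(2) G unfolding r_def by (subst (asm) sum_nonneg_eq_0_iff) auto
    then have "\<forall>g\<in>G. poly_eval g (fst z) \<ge> 0" by (auto simp: max_def split: if_splits)
    moreover have "norm (fst z) = 1" "snd z \<noteq> 0" using z(1) by (auto simp: K_def)
    ultimately show ?thesis using pd[of "fst z"] by (auto simp: pos_def_def f_def)
  qed
  ultimately obtain c \<epsilon> where c: "c > 0" "\<epsilon> > 0" and bound: "\<And>z. z \<in> K \<Longrightarrow> f z + c * r z \<ge> \<epsilon>"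
    using compact_penalty[of K f r] by metis
  \<comment> \<open>The cost \<open>c / (2 * k)\<close> for each member of \<open>G\<close> must
    stay below \<epsilon> in total.\<close>
  obtain k :: nat where k: "c * real (card G) / \<epsilon> < real k" using reals_Archimedean2 by blast
  have "0 \<le> c * real (card G) / \<epsilon>" using c by simp
  then have k0: "k > 0" using k by (cases k) auto
  have ck: "c * real (card G) / real (2 * k) < \<epsilon>"
  proof -
    have "c * real (card G) < \<epsilon> * real k" using k c by (simp add: field_simps)
    also have "\<dots> \<le> \<epsilon> * real (2 * k)" using c by simp
    finally show ?thesis using k0 by (simp add: field_simps)
  qed
  have "v \<bullet> (pmat_eval F x *v v) > c * (\<Sum>g\<in>G. (poly_eval g x - 1) ^ (2 * k) * poly_eval g x)"
    if x: "norm x = 1" and v: "norm v = 1" for x v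
  proof -
    have "(\<Sum>g\<in>G. (poly_eval g x - 1) ^ (2 * k) * poly_eval g x) \<le>
        (\<Sum>g\<in>G. 1 / real (2 * k) - max 0 (- poly_eval g x))"
      using x k0 g_le by (intro sum_mono penalty_term_le) auto
    also have "\<dots> = real (card G) / real (2 * k) - r (x, v)"
      by (simp add: sum_subtractf r_def)
    finally have "c * (\<Sum>g\<in>G. (poly_eval g x - 1) ^ (2 * k) * poly_eval g x) \<le>
        c * (real (card G) / real (2 * k) - r (x, v))"
      using c by (intro mult_left_mono) auto
    also have "\<dots> = c * real (card G) / real (2 * k) - c * r (x, v)" by (simp add: right_diff_distrib)
    also have "\<dots> < \<epsilon> - c * r (x, v)" using ck by linarith
    also have "\<dots> \<le> f (x, v)" using bound[of "(x, v)"] x v by (simp add: K_def)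
    finally show ?thesis by (simp add: f_def)
  qed
  then show ?thesis using that c(1) k0 by blast
qed

text \<open>Powers of \<open>sq_norm\<close>, which is 1 on the sphere, bring \<open>F\<close> and
  the penalty \<open>h\<close> to the same degree. The difference \<open>H\<close> is then a form
  that is positive definite on the sphere, and \<open>h\<close> itself lies in
  \<open>qmodule_poly G\<close>, so it can be added back.\<close>

theorem pos_def_form_in_matrix_cone_qmodule:
  fixes F :: "('n::finite, 't::finite) pmat"
  assumes G: "finite G" and G_hom: "\<And>g. g \<in> G \<Longrightarrow> \<exists>k. even k \<and> homogeneous_poly k g"
    and g_le: "\<And>g x. g \<in> G \<Longrightarrow> norm x = 1 \<Longrightarrow> \<bar>poly_eval g x\<bar> \<le> 1"
    and sym: "sym_matrix F" and hom: "homogeneous_pmat (2 * d) F"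
    and pd: "\<And>x. norm x = 1 \<Longrightarrow> \<forall>g\<in>G. poly_eval g x \<ge> 0 \<Longrightarrow> pos_def (pmat_eval F x)"
  shows "\<exists>N>0. scale_pmat (sq_norm ^ N) F \<in> matrix_cone (qmodule_poly G)"
proof -
  have "\<forall>g\<in>G. \<exists>m. homogeneous_poly (2 * m) g"
    using G_hom by (metis evenE)
  then obtain m where m: "\<And>g. g \<in> G \<Longrightarrow> homogeneous_poly (2 * m g) g"
    unfolding bchoice_iff by blast
  obtain c k where c: "c > 0" and k: "k > 0" and pos: "\<And>x v. norm x = 1 \<Longrightarrow> norm v = 1 \<Longrightarrow>
      v \<bullet> (pmat_eval F x *v v) > c * (\<Sum>g\<in>G. (poly_eval g x - 1) ^ (2 * k) * poly_eval g x)"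
    using penalised_pos_def[OF G g_le pd] by blast
  \<comment> \<open>Half the degree of the homogenised penalty term for \<open>g\<close>.\<close>
  define e where "e g = m g * (2 * k + 1)" for g
  \<comment> \<open>An upper bound for \<open>d\<close> and all \<open>e g\<close>; the summand 1
    makes the final exponent positive.\<close>
  define E where "E = d + 1 + (\<Sum>g\<in>G. e g)"
  \<comment> \<open>Homogenisation of \<open>c * (g - 1) ^ (2 * k)\<close>; still a sum of
    squares.\<close>
  define \<sigma> where "\<sigma> g = Const c * sq_norm ^ (E - e g) * (g - sq_norm ^ m g) ^ (2 * k)" for g :: "'n rpoly"
  define h where "h = (\<Sum>g\<in>G. \<sigma> g * g)"
  define H where "H = scale_pmat (sq_norm ^ (E - d)) F - scale_pmat h (mat 1)"
  have sq_norm_power: "homogeneous_poly (2 * l) (sq_norm ^ l :: 'n rpoly)" for l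
    using homogeneous_poly_power[OF homogeneous_sq_norm, of l] by (simp add: mult.commute)
  have h_hom: "homogeneous_poly (2 * E) h"
    unfolding h_def
  proof (intro homogeneous_poly_sum)
    fix g assume g: "g \<in> G"
    have "e g \<le> E" using G g member_le_sum[of g G e] by (simp add: E_def)
    then have deg: "0 + 2 * (E - e g) + (2 * k) * (2 * m g) + 2 * m g = 2 * E"
      by (simp add: e_def algebra_simps)
    have "homogeneous_poly (0 + 2 * (E - e g) + (2 * k) * (2 * m g) + 2 * m g) (\<sigma> g * g)"
      unfolding \<sigma>_def
      by (intro homogeneous_poly_mult homogeneous_poly_power homogeneous_poly_diff sq_norm_power m g
        homogeneous_poly_Const)
    then show "homogeneous_poly (2 * E) (\<sigma> g * g)" unfolding deg .
  qed
  have H_nth: "H $ i $ j = sq_norm ^ (E - d) * F $ i $ j - h * (mat 1 $ i $ j)" for i j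
    by (simp add: H_def)
  have "sym_matrix H"
    by (rule sym_matrixI) (simp add: H_nth sym_matrix_entry[OF sym] mat_def)
  moreover have "homogeneous_pmat (2 * E) H"
    unfolding homogeneous_pmat_iff
  proof (intro allI)
    fix i j
    have "homogeneous_poly (2 * (E - d) + 2 * d) (sq_norm ^ (E - d) * F $ i $ j)"
      using hom by (intro homogeneous_poly_mult sq_norm_power) (simp add: homogeneous_pmat_iff)
    moreover have "2 * (E - d) + 2 * d = 2 * E" by (simp add: E_def)
    ultimately show "homogeneous_poly (2 * E) (H $ i $ j)"
      unfolding H_nth using h_hom by (intro homogeneous_poly_diff) (simp_all add: mat_def)
  qed
  moreover have "pos_def (pmat_eval H x)" if x: "norm x = 1" for x
  proof (rule pos_def_unit)
    show "sym_matrix (pmat_eval H x)"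
      by (rule sym_matrixI) (simp add: H_nth sym_matrix_entry[OF sym] mat_def)
    fix v :: "real ^ 't" assume v: "norm v = 1"
    have hx: "poly_eval h x = c * (\<Sum>g\<in>G. (poly_eval g x - 1) ^ (2 * k) * poly_eval g x)"
      by (simp add: h_def \<sigma>_def x sum_distrib_left mult.assoc)
    have "pmat_eval H x = pmat_eval F x - poly_eval h x *\<^sub>R mat 1"
      by (simp add: vec_eq_iff H_nth x mat_def)
    then have "v \<bullet> (pmat_eval H x *v v) = v \<bullet> (pmat_eval F x *v v) - poly_eval h x * (v \<bullet> v)"
      by (simp add: matrix_vector_mult_diff_rdistrib inner_diff_right scaleR_matrix_vector_assoc[symmetric])
    then show "0 < v \<bullet> (pmat_eval H x *v v)"
      using pos[OF x v] v by (simp add: hx dot_square_norm)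
  qed
  ultimately obtain N where N: "scale_pmat (sq_norm ^ N) H \<in> matrix_cone sos"
    using pos_def_form_in_matrix_cone by blast
  have h: "sq_norm ^ N * h \<in> qmodule_poly G"
  proof (rule qmodule_poly_mult_sos)
    show "sq_norm ^ N \<in> sos" by (intro sos_power sos_sq_norm)
    have "(g - sq_norm ^ m g) ^ (2 * k) \<in> sos" for g
      using sos_square[of "(g - sq_norm ^ m g) ^ k"] by (simp add: power_mult[symmetric] mult.commute)
    then have "\<sigma> g \<in> sos" for g
      unfolding \<sigma>_def using c by (intro sos_mult sos_power[OF sos_sq_norm] sos_Const) simp_all
    then show "h \<in> qmodule_poly G"
      unfolding h_def by (intro qmodule_poly_sum qmodule_poly_generator)
  qed
  \<comment> \<open>The identity matrix is written as a product with its transpose to match the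
    generators of the cone.\<close>
  have "scale_pmat (sq_norm ^ (N + (E - d))) F =
      scale_pmat (sq_norm ^ N) H + scale_pmat (sq_norm ^ N * h) (transpose (mat 1) ** mat 1)"
    by (simp add: vec_eq_iff H_nth power_add algebra_simps)
  also have "\<dots> \<in> matrix_cone (qmodule_poly G)"
    using N h matrix_cone_mono[OF sos_subset_qmodule_poly]
    by (intro matrix_cone_add matrix_cone_generator) blast
  finally have "scale_pmat (sq_norm ^ (N + (E - d))) F \<in> matrix_cone (qmodule_poly G)" .
  moreover have "N + (E - d) > 0" by (simp add: E_def)
  ultimately show ?thesis by blast
qed

text \<open>A vector on which some constraint matrix is negative at \<open>x\<close> gives the form;
  a bound on the sphere permits normalising it.\<close>

lemma separating_form:
  fixes \<G> :: "('n::finite, 't::finite) pmat set"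
  assumes sym: "\<forall>G\<in>\<G>. sym_matrix G" and hom: "\<forall>G\<in>\<G>. \<exists>k. even k \<and> homogeneous_pmat k G"
    and x: "x \<notin> psd_set \<G>"
  obtains g where "\<exists>k. even k \<and> homogeneous_poly k g" and "scale_pmat g (mat 1) \<in> qmodule_pmat \<G>"
    and "\<And>z. norm z = 1 \<Longrightarrow> \<bar>poly_eval g z\<bar> \<le> 1" and "poly_eval g x < 0"
proof -
  obtain A where A: "A \<in> \<G>" "\<not> pos_semidef (pmat_eval A x)" using x by (auto simp: psd_set_def)
  have "sym_matrix A" using sym A(1) by blast
  then have "sym_matrix (pmat_eval A x)"
    by (intro sym_matrixI) (simp add: sym_matrix_entry[of A])
  then obtain v where v: "v \<bullet> (pmat_eval A x *v v) < 0"
    using A(2) unfolding pos_semidef_def by (meson not_le)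
  have "compact (poly_eval (quadratic_form_poly A v) ` sphere 0 1)"
    by (intro compact_continuous_image continuous_intros compact_sphere)
  then have "bounded (poly_eval (quadratic_form_poly A v) ` sphere 0 1)" by (rule compact_imp_bounded)
  then obtain b where b0: "b > 0"
    and "\<forall>y\<in>poly_eval (quadratic_form_poly A v) ` sphere 0 1. norm y \<le> b"
    unfolding bounded_pos by (elim exE conjE)
  then have b: "\<bar>poly_eval (quadratic_form_poly A v) z\<bar> \<le> b" if "norm z = 1" for z
    using that by simp
  \<comment> \<open>Rescaling the vector divides the form by \<open>b\<close> and keeps it of the
    shape v^T A v.\<close>
  define w where "w = (1 / sqrt b) *\<^sub>R v"
  have eval: "poly_eval (quadratic_form_poly A w) z = poly_eval (quadratic_form_poly A v) z / b" for z
    using b0 by (simp add: poly_eval_quadratic_form_poly w_def matrix_vector_mult_scaleR)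
  show ?thesis
  proof (rule that[of "quadratic_form_poly A w"])
    show "\<exists>k. even k \<and> homogeneous_poly k (quadratic_form_poly A w)"
    proof -
      obtain k where "even k" "homogeneous_pmat k A" using hom A(1) by blast
      then show ?thesis by (intro exI[of _ k] conjI homogeneous_quadratic_form_poly)
    qed
    show "scale_pmat (quadratic_form_poly A w) (mat 1) \<in> qmodule_pmat \<G>"
      by (rule quadratic_form_poly_in_qmodule[OF A(1)])
    show "\<bar>poly_eval (quadratic_form_poly A w) z\<bar> \<le> 1" if "norm z = 1" for z
      using b[OF that] b0 by (simp add: eval)
    show "poly_eval (quadratic_form_poly A w) x < 0"
      unfolding eval using v b0 by (simp add: poly_eval_quadratic_form_poly divide_neg_pos)
  qed
qed

theorem theorem4p2:
  fixes \<G> :: "('n::finite, 't::finite) pmat set"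
    and F :: "('n, 't) pmat"
    and d :: nat
  assumes "finite \<G>"
    and "\<forall>G\<in>\<G>. sym_matrix G"
    and "\<forall>G\<in>\<G>. \<exists>k. even k \<and> homogeneous_pmat k G"
    and "sym_matrix F"
    and "homogeneous_pmat d F"
    and "even d" and "d > 0"
    and "\<forall>x \<in> psd_set \<G> - {0}. pos_def (pmat_eval F x)"
  shows "\<exists>(G :: 'n rpoly set) (N :: nat).
           finite G \<and> (\<forall>g\<in>G. \<exists>k. even k \<and> homogeneous_poly k g) \<and> N > 0 \<and>
           scale_pmat ((\<Sum>i\<in>UNIV. Var i ^ 2) ^ N) F \<in> matrix_cone (qmodule_poly G) \<and>
           (matrix_cone (qmodule_poly G) :: ('n, 't) pmat set) \<subseteq> qmodule_pmat \<G>"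
proof -
  \<comment> \<open>Points of the sphere together with unit vectors that witness the failure of
    positive definiteness of \<open>F\<close>.\<close>
  define T where "T = {z \<in> sphere (0 :: real ^ 'n) 1 \<times> sphere (0 :: real ^ 't) 1.
    snd z \<bullet> (pmat_eval F (fst z) *v snd z) \<le> 0}"
  \<comment> \<open>All normalised forms of even degree that may be used as scalar
    constraints.\<close>
  define C where "C = {g :: 'n rpoly. (\<exists>k. even k \<and> homogeneous_poly k g) \<and>
    scale_pmat g (mat 1) \<in> qmodule_pmat \<G> \<and> (\<forall>z. norm z = 1 \<longrightarrow> \<bar>poly_eval g z\<bar> \<le> 1)}"
  have "compact T"
  proof -
    have "closed {z :: (real ^ 'n) \<times> (real ^ 't). snd z \<bullet> (pmat_eval F (fst z) *v snd z) \<le> 0}"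
      unfolding inner_matrix_vector pmat_eval_nth by (intro closed_Collect_le continuous_intros)
    then have "compact ((sphere (0 :: real ^ 'n) 1 \<times> sphere (0 :: real ^ 't) 1) \<inter>
        {z. snd z \<bullet> (pmat_eval F (fst z) *v snd z) \<le> 0})"
      by (intro compact_Int_closed compact_Times compact_sphere)
    moreover have "T = (sphere (0 :: real ^ 'n) 1 \<times> sphere (0 :: real ^ 't) 1) \<inter>
        {z. snd z \<bullet> (pmat_eval F (fst z) *v snd z) \<le> 0}"
      by (auto simp: T_def)
    ultimately show ?thesis by simp
  qed
  then have "compact (fst ` T)"
    by (intro compact_continuous_image continuous_intros)
  moreover have "open {x. poly_eval g x < 0}" for g :: "'n rpoly"
    by (intro open_Collect_less continuous_intros)
  \<comment> \<open>Points of the projection lie outside \<open>psd_set \<G>\<close>, hence each is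
    separated by some form in \<open>C\<close>.\<close>
  moreover have "fst ` T \<subseteq> (\<Union>g\<in>C. {x. poly_eval g x < 0})"
  proof
    fix x assume "x \<in> fst ` T"
    then obtain v where v: "norm x = 1" "norm v = 1" "v \<bullet> (pmat_eval F x *v v) \<le> 0"
      by (auto simp: T_def)
    then have "v \<noteq> 0" by auto
    then have "\<not> pos_def (pmat_eval F x)"
      using v(3) unfolding pos_def_def by (meson not_le)
    moreover have "x \<noteq> 0" using v(1) by auto
    ultimately have "x \<notin> psd_set \<G>" using assms(8) by blast
    then obtain g where "\<exists>k. even k \<and> homogeneous_poly k g" "scale_pmat g (mat 1) \<in> qmodule_pmat \<G>"
      "\<And>z. norm z = 1 \<Longrightarrow> \<bar>poly_eval g z\<bar> \<le> 1" and gx: "poly_eval g x < 0"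
      by (rule separating_form[OF assms(2,3)]) (rule that)
    then have "g \<in> C" by (simp add: C_def)
    then show "x \<in> (\<Union>g\<in>C. {x. poly_eval g x < 0})" using gx by (intro UN_I CollectI)
  qed
  \<comment> \<open>A finite subcover gives the finite set of forms.\<close>
  ultimately obtain G where G: "G \<subseteq> C" "finite G" "fst ` T \<subseteq> (\<Union>g\<in>G. {x. poly_eval g x < 0})"
    by (rule compactE_image)
  obtain d' where d': "d = 2 * d'" using \<open>even d\<close> by blast
  have "\<exists>N>0. scale_pmat (sq_norm ^ N) F \<in> matrix_cone (qmodule_poly G)"
  proof (rule pos_def_form_in_matrix_cone_qmodule)
    show "finite G" "sym_matrix F" "homogeneous_pmat (2 * d') F" using G(2) assms(4,5) d' by simp_all
    show "\<exists>k. even k \<and> homogeneous_poly k g" if "g \<in> G" for g using that G(1) C_def by blast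
    show "\<bar>poly_eval g x\<bar> \<le> 1" if "g \<in> G" "norm x = 1" for g x using that G(1) C_def by blast
    show "pos_def (pmat_eval F x)" if x: "norm x = 1" "\<forall>g\<in>G. 0 \<le> poly_eval g x" for x
    proof (rule pos_def_unit)
      show "sym_matrix (pmat_eval F x)"
        by (rule sym_matrixI) (simp add: sym_matrix_entry[OF assms(4)])
      fix v :: "real ^ 't" assume v: "norm v = 1"
      show "0 < v \<bullet> (pmat_eval F x *v v)"
      \<comment> \<open>Otherwise \<open>x\<close> would lie in the projection of \<open>T\<close>,
        where some \<open>g\<close> in \<open>G\<close> is negative.\<close>
      proof (rule ccontr)
        assume "\<not> ?thesis"
        then have "(x, v) \<in> T" using x v by (simp add: T_def)
        then have "x \<in> (\<Union>g\<in>G. {x. poly_eval g x < 0})" using G(3) by force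
        then show False using x(2) by force
      qed
    qed
  qed
  then obtain N where N: "N > 0" "scale_pmat (sq_norm ^ N) F \<in> matrix_cone (qmodule_poly G)"
    by (elim exE conjE)
  have sub: "(matrix_cone (qmodule_poly G) :: ('n, 't) pmat set) \<subseteq> qmodule_pmat \<G>"
    using G(1) by (intro matrix_cone_subset_qmodule_pmat) (auto simp: C_def)
  have even: "\<forall>g\<in>G. \<exists>k. even k \<and> homogeneous_poly k g" using G(1) C_def by blast
  show ?thesis
    by (intro exI[of _ G] exI[of _ N] conjI G(2) even N(1) N(2)[unfolded sq_norm_def] sub)
qed

end
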